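(* Let $a>0$ and let $\mu$ be a nonzero positive finite Borel measure on $[a,\infty)$. Put $$g(x)=\int_{a}^\infty\frac{d\mu(t)}{x-it},\qquad x\in\mathbb{R}.$$ Then the Gabor system $\mathcal{G}(g;\alpha,\beta)$ is a frame in $L^2(\mathbb{R})$ for all $\alpha,\beta>0$ with $\alpha\beta\le 1$.
   Context: For $g\in L^2(\mathbb{R})$ and $t,\omega\in\mathbb{R}$ put $\pi_{t,\omega}g(x)=e^{2\pi i\omega x}g(x-t)$. For $\alpha,\beta>0$ the Gabor system is $\mathcal{G}(g;\alpha,\beta)=\{\pi_{\alpha m,\beta n}g\}_{m,n\in\mathbb{Z}}$. It is a frame in $L^2(\mathbb{R})$ if there are constants $A,B>0$ such that for all $h\in L^2(\mathbb{R})$, $A\|h\|^2\le\sum_{m,n\in\mathbb{Z}}|(h,\pi_{\alpha m,\beta n}g)|^2\le B\|h\|^2$, where $(\cdot,\cdot)$ and $\|\cdot\|$ are the inner product and norm of $L^2(\mathbb{R})$. *)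

theory Defs
  imports "HOL-Analysis.Analysis"
begin

(* Elements of L^2(R) are represented by Borel measurable functions; every
   Lebesgue class contains one, and all notions below depend only on the
   class modulo null sets. *)
definition square_integrable :: "(real \<Rightarrow> complex) set" where
  "square_integrable =
     {h \<in> borel_measurable lborel. integrable lborel (\<lambda>x. (cmod (h x))\<^sup>2)}"

definition ip_L2 :: "(real \<Rightarrow> complex) \<Rightarrow> (real \<Rightarrow> complex) \<Rightarrow> complex" where
  "ip_L2 h g = (\<integral>x. h x * cnj (g x) \<partial>lborel)"

definition norm_L2 :: "(real \<Rightarrow> complex) \<Rightarrow> real" where
  "norm_L2 h = sqrt (\<integral>x. (cmod (h x))\<^sup>2 \<partial>lborel)"

definition time_freq_shift :: "real \<Rightarrow> real \<Rightarrow> (real \<Rightarrow> complex) \<Rightarrow> real \<Rightarrow> complex" where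
  "time_freq_shift t \<omega> g x = exp (2 * of_real pi * \<i> * of_real \<omega> * of_real x) * g (x - t)"

(* The system is an indexed family, not a set, so repeated elements count
   with multiplicity in the frame sum. *)
definition gabor_system ::
    "(real \<Rightarrow> complex) \<Rightarrow> real \<Rightarrow> real \<Rightarrow> int \<times> int \<Rightarrow> real \<Rightarrow> complex" where
  "gabor_system g \<alpha> \<beta> = (\<lambda>(m, n). time_freq_shift (\<alpha> * of_int m) (\<beta> * of_int n) g)"

(* Membership of the family in L^2 and summability are required explicitly:
   a Bochner integral that does not exist and a divergent infinite sum of
   reals both have the value 0. *)
definition is_frame_L2 :: "('i \<Rightarrow> real \<Rightarrow> complex) \<Rightarrow> bool" where
  "is_frame_L2 f \<longleftrightarrow>
     (\<forall>i. f i \<in> square_integrable) \<and>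
     (\<exists>A>0. \<exists>B>0. \<forall>h\<in>square_integrable.
        (\<lambda>i. (cmod (ip_L2 h (f i)))\<^sup>2) summable_on UNIV \<and>
        A * (norm_L2 h)\<^sup>2 \<le> (\<Sum>\<^sub>\<infinity>i. (cmod (ip_L2 h (f i)))\<^sup>2) \<and>
        (\<Sum>\<^sub>\<infinity>i. (cmod (ip_L2 h (f i)))\<^sup>2) \<le> B * (norm_L2 h)\<^sup>2)"

end

theory Submission
  imports Defs "HOL-Probability.Sinc_Integral"
begin

text \<open>
Write \<open>G\<close> for the complex conjugate of the window \<open>g\<close>, and put \<open>T = 1/\<beta>\<close>, \<open>\<Lambda> = 2\<pi>/\<alpha>\<close> and
\<open>L = 2\<pi>\<beta>\<close>, so that \<open>L \<le> \<Lambda>\<close> is the hypothesis \<open>\<alpha>\<beta> \<le> 1\<close>. Suppose that \<open>h\<close> has bounded support.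
For fixed \<open>m\<close> the numbers \<open>(h, \<pi>\<^bsub>\<alpha>m,\<beta>n\<^esub>g)\<close> are the Fourier coefficients on \<open>[0,T]\<close> of the finite sum
\<open>F\<^sub>m(x) = \<Sum>\<^sub>k h(x+kT) G(x+kT-\<alpha>m)\<close>, so by Parseval's identity and integration over \<open>x\<close> the frame
inequalities follow from
\<open>A \<Sum>\<^sub>k |c\<^sub>k|\<^sup>2 \<le> \<Sum>\<^sub>m |\<Sum>\<^sub>k c\<^sub>k G(y\<^sub>k - \<alpha>m)|\<^sup>2 \<le> B \<Sum>\<^sub>k |c\<^sub>k|\<^sup>2\<close>, where \<open>y\<^sub>k = x+kT\<close>,
for all finite sequences \<open>c\<close>, with constants independent of \<open>x\<close> and of the length of \<open>c\<close>. These
bounds are \<open>window_sum_lower\<close> and \<open>window_sum_upper\<close>; functions of unbounded support are reached by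
truncation in \<open>is_frame_L2_from_bounded_support\<close>.

Since \<open>G(y)\<close> is the integral of \<open>1/(y+it)\<close> against \<open>\<mu>\<close>, consider a single \<open>t > 0\<close> first. Let
\<open>p(s) = \<Sum>\<^sub>k c\<^sub>k exp(i y\<^sub>k s)\<close> and \<open>u(s) = \<Sum>\<^sub>j\<^sub>\<ge>\<^sub>0 exp(-tj\<Lambda>) p(s+j\<Lambda>)\<close>. Folding the Laplace integral of \<open>1/(y+it)\<close>
modulo \<open>\<Lambda>\<close> shows that the values \<open>i \<Sum>\<^sub>k c\<^sub>k/(y\<^sub>k-\<alpha>m+it)\<close> are the Fourier coefficients on \<open>[0,\<Lambda>]\<close> of
\<open>exp(-ts) u(s)\<close>. With Parseval this gives the upper bound, uniformly for \<open>t \<ge> a\<close>.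

For the lower bound, pair these coefficients with those of \<open>p\<close> restricted to \<open>[0,L]\<close>, which is a
part of \<open>[0,\<Lambda>]\<close>. By Parseval the real part of the pairing is \<open>\<Lambda>\<close> times the integral over \<open>[0,L]\<close> of
\<open>exp(-ts) Re(u cnj p)\<close>, and \<open>2 Re(u cnj p) = |u|\<^sup>2 + |p|\<^sup>2 - |u-p|\<^sup>2\<close> with \<open>u(s) - p(s) = exp(-t\<Lambda>) u(s+\<Lambda>)\<close>.
As \<open>|u|\<close> is \<open>L\<close>-periodic, a shift by \<open>\<Lambda>\<close> does not change its mean square over \<open>[0,L]\<close>, so the factor
\<open>exp(-2t\<Lambda>) \<le> exp(-tL)\<close> makes the last term smaller than the first one, and the term \<open>|p|\<^sup>2\<close> remains
(\<open>pairing_lower\<close>). The sequence paired with does not depend on \<open>t\<close>, so this inequality can be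
integrated against the positive measure \<open>\<mu>\<close> without cancellation, and the Cauchy-Schwarz inequality
turns it into the lower bound.
\<close>

section \<open>Square integrable functions on a segment\<close>

abbreviation seg :: "real \<Rightarrow> real measure" where
  "seg P \<equiv> restrict_space lborel {0..P}"

definition harmonic :: "real \<Rightarrow> int \<Rightarrow> real \<Rightarrow> complex" where
  "harmonic P n s = cis (2 * pi * of_int n * s / P)"

definition fourier_coeff :: "real \<Rightarrow> (real \<Rightarrow> complex) \<Rightarrow> int \<Rightarrow> complex" where
  "fourier_coeff P f n = (\<integral>s. f s * cnj (harmonic P n s) \<partial>seg P)"

definition L2_seg :: "real \<Rightarrow> (real \<Rightarrow> complex) set" where
  "L2_seg P = {f \<in> borel_measurable borel. integrable (seg P) (\<lambda>s. (cmod (f s))\<^sup>2)}"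

lemma finite_measure_seg: "finite_measure (seg P)"
  by (rule finite_measureI)
     (simp add: emeasure_restrict_space space_restrict_space emeasure_lborel_Icc_eq)

lemma measurable_segI:
  "f \<in> borel_measurable borel \<Longrightarrow> f \<in> borel_measurable (seg P)"
  by (simp add: measurable_restrict_space1)

lemma harmonic_continuous: "continuous_on A (harmonic P n)"
  unfolding harmonic_def cis_conv_exp divide_inverse by (intro continuous_intros)

lemma harmonic_measurable [measurable]: "harmonic P n \<in> borel_measurable borel"
  by (intro borel_measurable_continuous_onI harmonic_continuous)

lemma norm_harmonic [simp]: "cmod (harmonic P n s) = 1"
  by (simp add: harmonic_def)

lemma harmonic_mult_cnj: "harmonic P m s * cnj (harmonic P n s) = harmonic P (m - n) s"
  by (simp add: harmonic_def cis_cnj cis_mult cis_divide diff_divide_distrib algebra_simps)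

lemma harmonic_mult: "harmonic P m s * harmonic P n s = harmonic P (m + n) s"
  by (simp add: harmonic_def cis_mult add_divide_distrib algebra_simps)

lemma integral_seg_FTC:
  fixes f :: "real \<Rightarrow> complex"
  assumes "0 \<le> P"
    and "\<And>x. 0 \<le> x \<Longrightarrow> x \<le> P \<Longrightarrow> (F has_vector_derivative f x) (at x within {0..P})"
    and "continuous_on {0..P} f"
  shows "(\<integral>s. f s \<partial>seg P) = F P - F 0"
  using integral_FTC_atLeastAtMost[OF assms] by (simp add: integral_restrict_space)

lemma integral_harmonic:
  assumes "P > 0"
  shows "(\<integral>s. harmonic P n s \<partial>seg P) = (if n = 0 then of_real P else 0)"
proof (cases "n = 0")
  case True
  have "(\<integral>s. (1::complex) \<partial>seg P) = of_real P - of_real 0"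
    using assms
    by (intro integral_seg_FTC) (auto intro!: has_vector_derivative_real_field derivative_eq_intros)
  with True show ?thesis
    by (simp add: harmonic_def del: lebesgue_integral_const)
next
  case False
  define w where "w = 2 * pi * of_int n / P"
  have w: "w \<noteq> 0" using False assms by (simp add: w_def)
  have h: "harmonic P n s = exp (\<i> * of_real w * of_real s)" for s
    by (simp add: harmonic_def cis_conv_exp w_def mult.assoc)
  have "(\<integral>s. harmonic P n s \<partial>seg P)
      = exp (\<i> * of_real w * of_real P) / (\<i> * of_real w)
        - exp (\<i> * of_real w * of_real 0) / (\<i> * of_real w)"
  proof (rule integral_seg_FTC)
    fix x :: real
    have "((\<lambda>z. exp (\<i> * of_real w * z) / (\<i> * of_real w)) has_field_derivative
            exp (\<i> * of_real w * of_real x)) (at (of_real x))"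
      using w by (auto intro!: derivative_eq_intros)
    then show "((\<lambda>s. exp (\<i> * of_real w * of_real s) / (\<i> * of_real w))
        has_vector_derivative harmonic P n x) (at x within {0..P})"
      unfolding h by (rule has_vector_derivative_real_field[THEN has_vector_derivative_at_within])
  qed (use assms in \<open>auto intro: harmonic_continuous\<close>)
  also have "exp (\<i> * of_real w * of_real P) = harmonic P n P"
    by (simp add: h)
  also have "harmonic P n P = 1"
    using assms by (simp add: harmonic_def)
  finally show ?thesis using False by simp
qed

lemma integrable_seg_bounded:
  fixes f :: "real \<Rightarrow> 'a::{banach,second_countable_topology}"
  assumes "f \<in> borel_measurable borel" "\<And>s. s \<in> {0..P} \<Longrightarrow> norm (f s) \<le> B"
  shows "integrable (seg P) f"
  using assms
  by (intro finite_measure.integrable_const_bound[OF finite_measure_seg, of _ B] measurable_segI)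
     (auto simp: space_restrict_space intro!: AE_I2)

lemma L2_seg_bounded:
  assumes "f \<in> borel_measurable borel" "\<And>s. s \<in> {0..P} \<Longrightarrow> cmod (f s) \<le> B"
  shows "f \<in> L2_seg P"
  using assms by (auto simp: L2_seg_def intro!: integrable_seg_bounded[of _ _ "B\<^sup>2"] power_mono)

lemma cmod_mult_le_sum_squares: "cmod (a * b) \<le> (cmod a)\<^sup>2 + (cmod b)\<^sup>2"
proof -
  have "2 * (cmod a * cmod b) \<le> (cmod a)\<^sup>2 + (cmod b)\<^sup>2"
    using zero_le_power2[of "cmod a - cmod b"] by (simp add: power2_diff)
  moreover have "0 \<le> cmod a * cmod b" by simp
  ultimately show ?thesis unfolding norm_mult by linarith
qed

lemma two_Re_mult_cnj: "2 * Re (a * cnj b) = (cmod a)\<^sup>2 + (cmod b)\<^sup>2 - (cmod (a - b))\<^sup>2"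
  unfolding cmod_power2 by (simp add: power2_eq_square algebra_simps)

lemma cmod_add_square_le: "(cmod (a + b))\<^sup>2 \<le> 2 * (cmod a)\<^sup>2 + 2 * (cmod b)\<^sup>2"
proof -
  have "(cmod (a + b))\<^sup>2 \<le> (cmod a + cmod b)\<^sup>2"
    by (intro power_mono norm_triangle_ineq) auto
  also have "\<dots> \<le> 2 * (cmod a)\<^sup>2 + 2 * (cmod b)\<^sup>2"
    using zero_le_power2[of "cmod a - cmod b"] by (simp add: power2_diff power2_sum)
  finally show ?thesis .
qed

lemma L2_seg_add:
  assumes "f \<in> L2_seg P" "g \<in> L2_seg P"
  shows "(\<lambda>s. f s + g s) \<in> L2_seg P"
proof -
  have [measurable]: "f \<in> borel_measurable borel" "g \<in> borel_measurable borel"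
    using assms by (auto simp: L2_seg_def)
  have "integrable (seg P) (\<lambda>s. (cmod (f s + g s))\<^sup>2)"
  proof (rule Bochner_Integration.integrable_bound)
    show "integrable (seg P) (\<lambda>s. 2 * (cmod (f s))\<^sup>2 + 2 * (cmod (g s))\<^sup>2)"
      using assms by (auto simp: L2_seg_def)
    show "AE s in seg P. norm ((cmod (f s + g s))\<^sup>2) \<le> norm (2 * (cmod (f s))\<^sup>2 + 2 * (cmod (g s))\<^sup>2)"
      using cmod_add_square_le by (intro AE_I2) (fastforce intro: order_trans)
  qed (auto intro!: measurable_segI)
  then show ?thesis by (auto simp: L2_seg_def)
qed

lemma L2_seg_sum:
  assumes "finite K" "\<And>k. k \<in> K \<Longrightarrow> f k \<in> L2_seg P"
  shows "(\<lambda>s. \<Sum>k\<in>K. f k s) \<in> L2_seg P"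
  using assms
proof (induction K rule: finite_induct)
  case empty
  show ?case by (simp add: L2_seg_def)
next
  case (insert k K)
  then show ?case by (simp add: L2_seg_add)
qed

lemma L2_seg_mult_bounded:
  assumes "f \<in> L2_seg P" "g \<in> borel_measurable borel" "\<And>s. s \<in> {0..P} \<Longrightarrow> cmod (g s) \<le> B"
  shows "(\<lambda>s. g s * f s) \<in> L2_seg P"
proof -
  have [measurable]: "f \<in> borel_measurable borel" "g \<in> borel_measurable borel"
    using assms by (auto simp: L2_seg_def)
  have "integrable (seg P) (\<lambda>s. (cmod (g s * f s))\<^sup>2)"
  proof (rule Bochner_Integration.integrable_bound)
    show "integrable (seg P) (\<lambda>s. B\<^sup>2 * (cmod (f s))\<^sup>2)"
      using assms by (auto simp: L2_seg_def)
    show "AE s in seg P. norm ((cmod (g s * f s))\<^sup>2) \<le> norm (B\<^sup>2 * (cmod (f s))\<^sup>2)"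
      using assms(3)
      by (auto simp: norm_mult power_mult_distrib space_restrict_space 
               intro!: AE_I2 mult_right_mono power_mono)
  qed (auto intro!: measurable_segI)
  then show ?thesis by (auto simp: L2_seg_def)
qed

lemma L2_seg_integrable_mult:
  assumes "f \<in> L2_seg P" "g \<in> L2_seg P"
  shows "integrable (seg P) (\<lambda>s. f s * g s)"
proof (rule Bochner_Integration.integrable_bound)
  have [measurable]: "f \<in> borel_measurable borel" "g \<in> borel_measurable borel"
    using assms by (auto simp: L2_seg_def)
  show "integrable (seg P) (\<lambda>s. (cmod (f s))\<^sup>2 + (cmod (g s))\<^sup>2)"
    using assms by (auto simp: L2_seg_def)
  show "AE s in seg P. norm (f s * g s) \<le> norm ((cmod (f s))\<^sup>2 + (cmod (g s))\<^sup>2)"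
    using cmod_mult_le_sum_squares by (intro AE_I2) (auto intro: order_trans)
  show "(\<lambda>s. f s * g s) \<in> borel_measurable (seg P)"
    by (intro measurable_segI) measurable
qed

lemma borel_measurable_cnj [measurable (raw)]:
  "f \<in> borel_measurable M \<Longrightarrow> (\<lambda>x. cnj (f x)) \<in> borel_measurable M"
  by (rule borel_measurable_continuous_on[of cnj]) (intro continuous_intros)

lemma L2_seg_cnj: "f \<in> L2_seg P \<Longrightarrow> (\<lambda>s. cnj (f s)) \<in> L2_seg P"
  by (auto simp: L2_seg_def)

lemma harmonic_L2: "harmonic P n \<in> L2_seg P"
  by (rule L2_seg_bounded[of _ _ 1]) auto

definition trig_sum :: "real \<Rightarrow> (int \<Rightarrow> complex) \<Rightarrow> int set \<Rightarrow> real \<Rightarrow> complex" where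
  "trig_sum P d F s = (\<Sum>n\<in>F. d n * harmonic P n s)"

lemma trig_sum_measurable [measurable]: "trig_sum P d F \<in> borel_measurable borel"
  unfolding trig_sum_def by measurable

lemma trig_sum_L2: "trig_sum P d F \<in> L2_seg P"
proof (rule L2_seg_bounded[of _ _ "\<Sum>n\<in>F. cmod (d n)"])
  show "cmod (trig_sum P d F s) \<le> (\<Sum>n\<in>F. cmod (d n))" for s
    unfolding trig_sum_def by (rule order_trans[OF norm_sum]) (simp add: norm_mult)
qed simp

lemma integral_trig_sum_square:
  assumes "P > 0" "finite F"
  shows "(\<integral>s. (cmod (trig_sum P d F s))\<^sup>2 \<partial>seg P) = P * (\<Sum>n\<in>F. (cmod (d n))\<^sup>2)"
proof -
  have "complex_of_real (\<integral>s. (cmod (trig_sum P d F s))\<^sup>2 \<partial>seg P)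
      = (\<integral>s. complex_of_real ((cmod (trig_sum P d F s))\<^sup>2) \<partial>seg P)"
    by (rule integral_complex_of_real[symmetric])
  also have "\<dots> = (\<integral>s. (\<Sum>m\<in>F. \<Sum>n\<in>F. d m * cnj (d n) * harmonic P (m - n) s) \<partial>seg P)"
    by (intro Bochner_Integration.integral_cong refl)
       (simp add: trig_sum_def complex_norm_square[unfolded of_real_power[symmetric]] cnj_sum sum_product 
                  harmonic_mult_cnj[symmetric] mult_ac del: of_real_power)
  also have "\<dots> = (\<Sum>m\<in>F. \<Sum>n\<in>F. d m * cnj (d n) * (if m - n = 0 then of_real P else 0))"
  proof -
    have i: "integrable (seg P) (\<lambda>s. d m * cnj (d n) * harmonic P (m - n) s)" for m n
      by (rule integrable_seg_bounded[of _ _ "cmod (d m * cnj (d n))"]) (auto simp: norm_mult)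
    show ?thesis
      by (simp add: Bochner_Integration.integral_sum integrable_sum i integral_harmonic[OF assms(1)]
               del: Bochner_Integration.integrable_mult_right_iff cong: if_cong)
  qed
  also have "\<dots> = (\<Sum>m\<in>F. d m * cnj (d m) * of_real P)"
    using assms(2) by (simp add: if_distrib cong: if_cong)
  also have "\<dots> = complex_of_real (P * (\<Sum>n\<in>F. (cmod (d n))\<^sup>2))"
    unfolding complex_norm_square[symmetric] by (simp add: sum_distrib_left mult_ac)
  finally show ?thesis by (simp only: of_real_eq_iff)
qed

text \<open>Completing the square in each \<open>d n\<close>. The last sum vanishes when \<open>d\<close> consists of the normalised
Fourier coefficients, which gives Bessel's inequality; as it is nonnegative for every \<open>d\<close>, good
approximation by any trigonometric sum forces near equality in Bessel's inequality.\<close>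

lemma integral_trig_sum_diff_square:
  assumes "P > 0" "finite F" and f: "f \<in> L2_seg P"
  shows "(\<integral>s. (cmod (f s - trig_sum P d F s))\<^sup>2 \<partial>seg P)
      = (\<integral>s. (cmod (f s))\<^sup>2 \<partial>seg P) - (\<Sum>n\<in>F. (cmod (fourier_coeff P f n))\<^sup>2) / P
        + (\<Sum>n\<in>F. (cmod (P * d n - fourier_coeff P f n))\<^sup>2) / P"
proof -
  let ?q = "trig_sum P d F"
  have iq: "integrable (seg P) (\<lambda>s. (cmod (?q s))\<^sup>2)" and "integrable (seg P) (\<lambda>s. (cmod (f s))\<^sup>2)"
    using trig_sum_L2 f by (auto simp: L2_seg_def)
  have ic: "integrable (seg P) (\<lambda>s. f s * cnj (?q s))"
    by (intro L2_seg_integrable_mult f L2_seg_cnj trig_sum_L2)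
  have eq: "(cmod (f s - ?q s))\<^sup>2 = (cmod (f s))\<^sup>2 + (cmod (?q s))\<^sup>2 - 2 * Re (f s * cnj (?q s))" for s
    using two_Re_mult_cnj[of "f s" "?q s"] by linarith
  have "(\<integral>s. (cmod (f s - ?q s))\<^sup>2 \<partial>seg P)
      = (\<integral>s. (cmod (f s))\<^sup>2 \<partial>seg P) + (\<integral>s. (cmod (?q s))\<^sup>2 \<partial>seg P) - 2 * Re (\<integral>s. f s * cnj (?q s) \<partial>seg P)"
    unfolding eq using iq ic f by (simp add: L2_seg_def del: times_complex.sel)
  also have "(\<integral>s. f s * cnj (?q s) \<partial>seg P) = (\<Sum>n\<in>F. cnj (d n) * fourier_coeff P f n)"
  proof -
    have "(\<integral>s. f s * cnj (?q s) \<partial>seg P) = (\<integral>s. (\<Sum>n\<in>F. cnj (d n) * (f s * cnj (harmonic P n s))) \<partial>seg P)"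
      by (simp add: trig_sum_def cnj_sum sum_distrib_left mult_ac)
    also have "\<dots> = (\<Sum>n\<in>F. cnj (d n) * fourier_coeff P f n)"
      unfolding fourier_coeff_def
      by (subst Bochner_Integration.integral_sum)
         (auto intro!: integrable_mult_right L2_seg_integrable_mult f L2_seg_cnj harmonic_L2)
    finally show ?thesis .
  qed
  also have "(\<integral>s. (cmod (?q s))\<^sup>2 \<partial>seg P) = P * (\<Sum>n\<in>F. (cmod (d n))\<^sup>2)"
    by (rule integral_trig_sum_square[OF assms(1,2)])
  finally have A: "(\<integral>s. (cmod (f s - ?q s))\<^sup>2 \<partial>seg P)
      = (\<integral>s. (cmod (f s))\<^sup>2 \<partial>seg P) + (\<Sum>n\<in>F. P * (cmod (d n))\<^sup>2 - 2 * Re (cnj (d n) * fourier_coeff P f n))"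
    by (simp add: Re_sum sum_subtractf sum_distrib_left)
  have B: "P * (cmod d)\<^sup>2 - 2 * Re (cnj d * c) = (cmod (P * d - c))\<^sup>2 / P - (cmod c)\<^sup>2 / P"
    for d c :: complex
    using assms(1) unfolding cmod_power2 by (simp add: field_simps power2_eq_square)
  show ?thesis
    unfolding A B by (simp add: sum_subtractf sum_divide_distrib)
qed

section \<open>Density of trigonometric polynomials and Parseval's identity\<close>

text \<open>An inductive twin of \<open>trig_sum\<close>, without an explicit spectrum, in which closure under products is a
plain induction.\<close>

inductive trig_poly :: "real \<Rightarrow> (real \<Rightarrow> complex) \<Rightarrow> bool" for P where
  monom: "trig_poly P (\<lambda>s. d * harmonic P n s)"
| add: "trig_poly P p \<Longrightarrow> trig_poly P q \<Longrightarrow> trig_poly P (\<lambda>s. p s + q s)"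

lemma trig_poly_mult:
  assumes "trig_poly P p" "trig_poly P q"
  shows "trig_poly P (\<lambda>s. p s * q s)"
  using assms
proof (induction p rule: trig_poly.induct)
  case (monom d n)
  from monom.prems show ?case
  proof (induction q rule: trig_poly.induct)
    case (monom d' n')
    have "(\<lambda>s. d * harmonic P n s * (d' * harmonic P n' s)) = (\<lambda>s. (d * d') * harmonic P (n + n') s)"
      by (simp add: harmonic_mult[symmetric] mult_ac)
    then show ?case by (metis trig_poly.monom)
  next
    case (add p q)
    then show ?case by (simp add: distrib_left trig_poly.add)
  qed
next
  case (add p1 p2)
  then show ?case by (simp add: distrib_right trig_poly.add)
qed

lemma trig_poly_const: "trig_poly P (\<lambda>s. c)"
  using trig_poly.monom[of P c 0] by (simp add: harmonic_def)

lemma trig_poly_imp_trig_sum: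
  assumes "trig_poly P q"
  shows "\<exists>F d. finite F \<and> q = trig_sum P d F"
  using assms
proof induction
  case (monom d n)
  then show ?case
    by (intro exI[of _ "{n}"] exI[of _ "\<lambda>_. d"]) (auto simp: trig_sum_def)
next
  case (add p q)
  then obtain F d G e where *: "finite F" "p = trig_sum P d F" "finite G" "q = trig_sum P e G" by blast
  define d' where "d' n = (if n \<in> F then d n else 0)" for n
  define e' where "e' n = (if n \<in> G then e n else 0)" for n
  have "p s = (\<Sum>n\<in>F \<union> G. d' n * harmonic P n s)" for s
    unfolding * trig_sum_def by (rule sum.mono_neutral_cong_left) (use * in \<open>auto simp: d'_def\<close>)
  moreover have "q s = (\<Sum>n\<in>F \<union> G. e' n * harmonic P n s)" for s
    unfolding * trig_sum_def by (rule sum.mono_neutral_cong_left) (use * in \<open>auto simp: e'_def\<close>)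
  ultimately have "(\<lambda>s. p s + q s) = trig_sum P (\<lambda>n. d' n + e' n) (F \<union> G)"
    by (simp add: trig_sum_def fun_eq_iff sum.distrib distrib_right)
  then show ?case using * by blast
qed

text \<open>A real linear form with values \<open>a\<close> at \<open>1\<close> and \<open>b\<close> at \<open>\<i>\<close> is \<open>z \<mapsto> (a - ib)/2 z + (a + ib)/2 cnj z\<close>, and for
\<open>z\<close> the harmonic of index 1 the conjugate is the harmonic of index \<open>-1\<close>.\<close>

lemma real_polynomial_circle_trig_poly:
  assumes "real_polynomial_function (r :: complex \<Rightarrow> real)"
  shows "trig_poly P (\<lambda>s. complex_of_real (r (harmonic P 1 s)))"
  using assms
proof induction
  case (linear f)
  then interpret bounded_linear f .
  have "complex_of_real (f (harmonic P 1 s)) =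
     (of_real (f 1) / 2 - \<i> * of_real (f \<i>) / 2) * harmonic P 1 s +
     (of_real (f 1) / 2 + \<i> * of_real (f \<i>) / 2) * harmonic P (-1) s" for s
  proof -
    define z where "z = harmonic P 1 s"
    have z': "harmonic P (-1) s = cnj z"
      by (simp add: z_def harmonic_def cis_cnj)
    have "z = Re z *\<^sub>R 1 + Im z *\<^sub>R \<i>" by (simp add: complex_eq_iff)
    then have "f z = Re z * f 1 + Im z * f \<i>" by (metis add scaleR real_scaleR_def)
    then show ?thesis unfolding z' z_def[symmetric] 
      by (simp add: complex_eq_iff field_simps)
  qed
  then show ?case by (simp add: trig_poly.intros)
next
  case (const c)
  then show ?case by (rule trig_poly_const)
next
  case (add f g)
  then show ?case by (simp add: trig_poly.add)
next
  case (mult f g)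
  then show ?case by (simp add: trig_poly_mult)
qed

text \<open>Since \<open>h 0 = h P\<close>, \<open>h\<close> factors through the circle as a function \<open>H\<close>. The segment is compact, so the
map onto the circle is closed and \<open>H\<close> is continuous; then Stone-Weierstrass applies to \<open>H\<close>.\<close>

lemma trig_poly_uniform_approx:
  assumes P: "P > 0" and h: "continuous_on {0..P} h" "h 0 = h P" and e: "\<epsilon> > 0"
  shows "\<exists>q. trig_poly P q \<and> (\<forall>s\<in>{0..P}. cmod (h s - q s) < \<epsilon>)"
proof -
  let ?e = "harmonic P 1"
  let ?S = "?e ` {0..P}"
  have S: "compact ?S"
    by (intro compact_continuous_image harmonic_continuous) auto
  define H where "H z = h (SOME s. s \<in> {0..P} \<and> ?e s = z)" for z
  have inj: "h s = h s'" if s: "s \<in> {0..P}" "s' \<in> {0..P}" "?e s = ?e s'" for s s'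
  proof -
    obtain n :: int where n: "2 * pi * s / P = 2 * pi * s' / P + of_int n * (2 * pi)"
      using s(3) unfolding harmonic_def cis_conv_exp exp_eq
      by (auto simp: complex_eq_iff)
    have "2 * pi * (s / P) = 2 * pi * (s' / P + of_int n)"
      using n by (simp add: algebra_simps)
    then have "s / P = s' / P + of_int n" 
      using pi_neq_zero mult_cancel_left[of "2 * pi" "s / P" "s' / P + of_int n"] by simp
    then have n: "s = s' + of_int n * P"
      using P by (simp add: field_simps)
    have n3: "n = 0 \<or> n = 1 \<or> n = -1"
    proof -
      have "of_int n * P \<le> 1 * P" "(-1) * P \<le> of_int n * P" using s n by auto
      then have "real_of_int n \<le> 1" "-1 \<le> real_of_int n" using P by (simp_all only: mult_le_cancel_right_pos)
      then show ?thesis by linarith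
    qed
    then show ?thesis
    proof (elim disjE)
      assume "n = 1"
      then have "s = P" "s' = 0" using s n by auto
      then show ?thesis using h by simp
    next
      assume "n = -1"
      then have "s = 0" "s' = P" using s n by auto
      then show ?thesis using h by simp
    qed (use n in auto)
  qed
  have H: "H (?e s) = h s" if "s \<in> {0..P}" for s
  proof -
    have "(SOME t. t \<in> {0..P} \<and> ?e t = ?e s) \<in> {0..P} \<and> ?e (SOME t. t \<in> {0..P} \<and> ?e t = ?e s) = ?e s"
      by (rule someI[of _ s]) (use that in auto)
    then show ?thesis unfolding H_def using inj that by blast
  qed
  have contH: "continuous_on ?S H"
    unfolding continuous_on_closed_vimage[OF compact_imp_closed[OF S]]
  proof safe
    fix B :: "complex set" assume B: "closed B"
    have "H -` B \<inter> ?S = ?e ` (h -` B \<inter> {0..P})"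
      using H by (auto simp: image_iff Bex_def)
    moreover have "compact (h -` B \<inter> {0..P})"
      using continuous_closed_preimage[OF h(1) closed_atLeastAtMost B]
      by (metis Int_commute compact_Icc compact_Int_closed inf.left_idem inf_commute)
    ultimately show "closed (H -` B \<inter> ?S)"
      by (metis compact_continuous_image harmonic_continuous compact_imp_closed)
  qed
  obtain g :: "complex \<Rightarrow> complex" where g: "polynomial_function g" "\<And>z. z \<in> ?S \<Longrightarrow> cmod (H z - g z) < \<epsilon>"
    using Stone_Weierstrass_polynomial_function[OF S contH e] by blast
  have re: "real_polynomial_function (\<lambda>z. Re (g z))" "real_polynomial_function (\<lambda>z. Im (g z))"
    using g(1) bounded_linear_Re bounded_linear_Im by (auto simp: polynomial_function_def o_def)
  have "trig_poly P (\<lambda>s. of_real (Re (g (?e s))) + \<i> * of_real (Im (g (?e s))))"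
    by (intro trig_poly.add trig_poly_mult trig_poly_const real_polynomial_circle_trig_poly re)
  then have "trig_poly P (\<lambda>s. g (?e s))"
    by (simp flip: complex_eq)
  moreover have "cmod (h s - g (?e s)) < \<epsilon>" if "s \<in> {0..P}" for s
    using g(2)[of "?e s"] H[OF that] that by auto
  ultimately show ?thesis by blast
qed

text \<open>A measurable function is an almost everywhere limit of continuous functions \<open>g n\<close>. Projecting their
values to the disc of radius \<open>B\<close> makes dominated convergence available, and the cutoff \<open>\<phi> n\<close>, which
vanishes at both ends of the segment and tends to 1 inside, makes the end values agree.\<close>

lemma L2_seg_continuous_approx:
  assumes P: "P > 0" and f: "f \<in> borel_measurable borel" and B: "\<And>s. cmod (f s) \<le> B"
    and e: "\<epsilon> > 0"
  shows "\<exists>h. continuous_on UNIV h \<and> h 0 = h P \<and> (\<integral>s. (cmod (f s - h s))\<^sup>2 \<partial>seg P) < \<epsilon>"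
proof -
  have B0: "B \<ge> 0" using B[of 0] norm_ge_zero order_trans by blast
  have "f measurable_on UNIV"
    using f by (intro lebesgue_measurable_imp_measurable_on) (auto intro: measurable_completion)
  then obtain N g where N: "negligible N" and g: "\<And>n. continuous_on UNIV (g n)"
    and lim: "\<And>x. x \<notin> N \<Longrightarrow> (\<lambda>n. g n x) \<longlonglongrightarrow> f x"
    by (auto simp: measurable_on_def)
  define \<phi> where "\<phi> n s = max 0 (min 1 (real n * (s * (P - s))))" for n s
  define h where "h n s = \<phi> n s *\<^sub>R closest_point (cball 0 B) (g n s)" for n s
  have ne: "cball (0::complex) B \<noteq> {}" using B0 by auto
  have h_cont: "continuous_on UNIV (h n)" for n
  proof -
    have "continuous_on UNIV (\<lambda>s. closest_point (cball 0 B) (g n s))"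
      using continuous_on_compose[OF g[of n] continuous_on_closest_point[OF convex_cball closed_cball ne]]
      by (simp add: o_def)
    then show ?thesis unfolding h_def \<phi>_def by (intro continuous_intros)
  qed
  have [measurable]: "h n \<in> borel_measurable borel" "f \<in> borel_measurable borel" for n
    using borel_measurable_continuous_onI h_cont f by blast+
  have cpB: "cmod (closest_point (cball 0 B) z) \<le> B" for z
    using closest_point_in_set[OF closed_cball ne, of z] by simp
  have hB: "cmod (h n s) \<le> B" for n s
    using cpB[of "g n s"] B0 by (auto simp: h_def \<phi>_def intro!: mult_le_one mult_left_le_one_le[THEN order_trans])
  have "(\<lambda>n. \<integral>s. (cmod (f s - h n s))\<^sup>2 \<partial>seg P) \<longlonglongrightarrow> (\<integral>s. 0 \<partial>seg P)"
  proof (rule integral_dominated_convergence[where w = "\<lambda>_. (2 * B)\<^sup>2"])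
    show "integrable (seg P) (\<lambda>_. (2 * B)\<^sup>2)"
      using finite_measure.integrable_const[OF finite_measure_seg] by blast
    show "AE s in seg P. norm ((cmod (f s - h n s))\<^sup>2) \<le> (2 * B)\<^sup>2" for n
    proof (intro AE_I2)
      fix s show "norm ((cmod (f s - h n s))\<^sup>2) \<le> (2 * B)\<^sup>2"
        using norm_triangle_ineq4[of "f s" "h n s"] B[of s] hB[of n s]
        unfolding real_norm_def abs_of_nonneg[OF zero_le_power2] by (intro power_mono) auto
    qed
    have "AE s in completion lborel. s \<notin> N"
      using N AE_not_in negligible_iff_null_sets by blast
    then have "AE s in lborel. s \<notin> N"
      by (simp add: AE_completion_iff)
    then have "AE s in lborel. s \<notin> N \<union> {0, P}"
      using AE_lborel_singleton[of 0] AE_lborel_singleton[of P] by eventually_elim auto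
    then have "AE s in seg P. s \<notin> N \<union> {0, P}"
      by (subst AE_restrict_space_iff) auto
    then show "AE s in seg P. (\<lambda>n. (cmod (f s - h n s))\<^sup>2) \<longlonglongrightarrow> 0"
      using AE_space
    proof eventually_elim
      case (elim s)
      have s: "0 < s" "s < P" using elim by (auto simp: space_restrict_space)
      have "(\<lambda>n. closest_point (cball 0 B) (g n s)) \<longlonglongrightarrow> closest_point (cball 0 B) (f s)"
        using lim[of s] elim by (intro continuous_on_tendsto_compose[OF continuous_on_closest_point[OF convex_cball closed_cball ne, of UNIV]]) auto
      then have cp: "(\<lambda>n. closest_point (cball 0 B) (g n s)) \<longlonglongrightarrow> f s"
        using B[of s] by (simp add: closest_point_self)
      have "eventually (\<lambda>n. \<phi> n s = 1) sequentially"
      proof -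
        obtain n0 :: nat where n0: "1 / (s * (P - s)) \<le> real n0" using real_arch_simple by blast
        have "\<phi> n s = 1" if "n \<ge> n0" for n
        proof -
          have "1 / (s * (P - s)) \<le> real n" using n0 that by linarith
          then have "1 \<le> real n * (s * (P - s))" using s by (simp add: field_simps)
          then show ?thesis by (simp add: \<phi>_def)
        qed
        then show ?thesis by (auto simp: eventually_sequentially)
      qed
      then have "(\<lambda>n. \<phi> n s) \<longlonglongrightarrow> 1" by (rule tendsto_eventually)
      from tendsto_scaleR[OF this cp] have "(\<lambda>n. h n s) \<longlonglongrightarrow> f s"
        by (simp add: h_def)
      then have "(\<lambda>n. (cmod (f s - h n s))\<^sup>2) \<longlonglongrightarrow> (cmod (f s - f s))\<^sup>2"
        by (intro tendsto_intros)
      then show ?case by simp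
    qed
  qed (auto intro!: measurable_segI)
  then have "eventually (\<lambda>n. (\<integral>s. (cmod (f s - h n s))\<^sup>2 \<partial>seg P) < \<epsilon>) sequentially"
    using e by (intro order_tendstoD(2)[of _ 0]) auto
  then obtain n where "(\<integral>s. (cmod (f s - h n s))\<^sup>2 \<partial>seg P) < \<epsilon>"
    by (auto simp: eventually_sequentially)
  moreover have "h n 0 = h n P" by (simp add: h_def \<phi>_def)
  ultimately show ?thesis using h_cont by blast
qed

lemma L2_seg_bounded_approx:
  assumes f: "f \<in> L2_seg P" and e: "\<epsilon> > 0"
  shows "\<exists>h B. h \<in> borel_measurable borel \<and> (\<forall>s. cmod (h s) \<le> B)
           \<and> (\<integral>s. (cmod (f s - h s))\<^sup>2 \<partial>seg P) < \<epsilon>"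
proof -
  have [measurable]: "f \<in> borel_measurable borel" and i: "integrable (seg P) (\<lambda>s. (cmod (f s))\<^sup>2)"
    using f by (auto simp: L2_seg_def)
  define h where "h n s = (if cmod (f s) \<le> real n then f s else 0)" for n s
  have [measurable]: "h n \<in> borel_measurable borel" for n
    unfolding h_def by measurable
  have "(\<lambda>n. \<integral>s. (cmod (f s - h n s))\<^sup>2 \<partial>seg P) \<longlonglongrightarrow> (\<integral>s. 0 \<partial>seg P)"
  proof (rule integral_dominated_convergence[OF _ _ i])
    show "AE s in seg P. (\<lambda>n. (cmod (f s - h n s))\<^sup>2) \<longlonglongrightarrow> 0"
    proof (intro AE_I2 tendsto_eventually)
      fix s
      obtain n0 :: nat where "cmod (f s) \<le> real n0" using real_arch_simple by blast
      then have "(cmod (f s - h n s))\<^sup>2 = 0" if "n \<ge> n0" for n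
        using that by (auto simp: h_def)
      then show "\<forall>\<^sub>F n in sequentially. (cmod (f s - h n s))\<^sup>2 = 0"
        by (auto simp: eventually_sequentially)
    qed
    show "AE s in seg P. norm ((cmod (f s - h n s))\<^sup>2) \<le> (cmod (f s))\<^sup>2" for n
      by (auto simp: h_def)
  qed (auto intro!: measurable_segI)
  then have "eventually (\<lambda>n. (\<integral>s. (cmod (f s - h n s))\<^sup>2 \<partial>seg P) < \<epsilon>) sequentially"
    using e by (intro order_tendstoD(2)[of _ 0]) auto
  then obtain n where "(\<integral>s. (cmod (f s - h n s))\<^sup>2 \<partial>seg P) < \<epsilon>"
    by (auto simp: eventually_sequentially)
  moreover have "cmod (h n s) \<le> real n" for s by (simp add: h_def)
  ultimately show ?thesis by (metis \<open>\<And>n. h n \<in> borel_measurable borel\<close>)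
qed

lemma L2_seg_diff_triangle:
  assumes "f \<in> L2_seg P" "g \<in> L2_seg P" "h \<in> L2_seg P"
  shows "(\<integral>s. (cmod (f s - h s))\<^sup>2 \<partial>seg P)
    \<le> 2 * (\<integral>s. (cmod (f s - g s))\<^sup>2 \<partial>seg P) + 2 * (\<integral>s. (cmod (g s - h s))\<^sup>2 \<partial>seg P)"
proof -
  have m: "(\<lambda>s. - g s) \<in> L2_seg P" "(\<lambda>s. - h s) \<in> L2_seg P"
    using assms by (auto simp: L2_seg_def)
  have i: "integrable (seg P) (\<lambda>s. (cmod (f s - h s))\<^sup>2)" "integrable (seg P) (\<lambda>s. (cmod (f s - g s))\<^sup>2)"
    "integrable (seg P) (\<lambda>s. (cmod (g s - h s))\<^sup>2)"
    using L2_seg_add[OF assms(1) m(2)] L2_seg_add[OF assms(1) m(1)] L2_seg_add[OF assms(2) m(2)]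
    by (auto simp: L2_seg_def)
  have "(\<integral>s. (cmod (f s - h s))\<^sup>2 \<partial>seg P) \<le> (\<integral>s. 2 * (cmod (f s - g s))\<^sup>2 + 2 * (cmod (g s - h s))\<^sup>2 \<partial>seg P)"
  proof (rule integral_mono)
    show "(cmod (f s - h s))\<^sup>2 \<le> 2 * (cmod (f s - g s))\<^sup>2 + 2 * (cmod (g s - h s))\<^sup>2" for s
      using cmod_add_square_le[of "f s - g s" "g s - h s"] by simp
  qed (use i in auto)
  then show ?thesis using i by simp
qed

lemma trig_sum_dense:
  assumes P: "P > 0" and f: "f \<in> L2_seg P" and e: "\<epsilon> > 0"
  shows "\<exists>F d. finite F \<and> (\<integral>s. (cmod (f s - trig_sum P d F s))\<^sup>2 \<partial>seg P) < \<epsilon>"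
proof -
  obtain g B where g: "g \<in> borel_measurable borel" "\<And>s. cmod (g s) \<le> B"
      "(\<integral>s. (cmod (f s - g s))\<^sup>2 \<partial>seg P) < \<epsilon> / 16"
    using L2_seg_bounded_approx[OF f, of "\<epsilon> / 16"] e by auto
  obtain h where h: "continuous_on UNIV h" "h 0 = h P" "(\<integral>s. (cmod (g s - h s))\<^sup>2 \<partial>seg P) < \<epsilon> / 16"
    using L2_seg_continuous_approx[OF P g(1,2), of "\<epsilon> / 16"] e by auto
  define \<delta> where "\<delta> = sqrt (\<epsilon> / (4 * P))"
  have \<delta>: "\<delta> > 0" "\<delta>\<^sup>2 * P = \<epsilon> / 4" using P e by (auto simp: \<delta>_def)
  obtain q where q: "trig_poly P q" "\<forall>s\<in>{0..P}. cmod (h s - q s) < \<delta>"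
    using trig_poly_uniform_approx[OF P continuous_on_subset[OF h(1)] h(2) \<delta>(1)] by auto
  obtain F d where F: "finite F" "q = trig_sum P d F"
    using trig_poly_imp_trig_sum[OF q(1)] by blast
  have hL: "h \<in> L2_seg P"
  proof -
    have "compact (h ` {0..P})" by (intro compact_continuous_image continuous_on_subset[OF h(1)]) auto
    then obtain C where "\<forall>z\<in>h ` {0..P}. cmod z \<le> C" using compact_imp_bounded bounded_iff by metis
    then show ?thesis using borel_measurable_continuous_onI[OF h(1)] by (intro L2_seg_bounded[of _ _ C]) auto
  qed
  have gL: "g \<in> L2_seg P" using g by (intro L2_seg_bounded[of _ _ B]) auto
  have qL: "q \<in> L2_seg P" unfolding F by (rule trig_sum_L2)
  have "(\<integral>s. (cmod (h s - q s))\<^sup>2 \<partial>seg P) \<le> (\<integral>s. \<delta>\<^sup>2 \<partial>seg P)"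
  proof (rule integral_mono)
    show "integrable (seg P) (\<lambda>s. (cmod (h s - q s))\<^sup>2)"
      using L2_seg_add[OF hL, of "\<lambda>s. - q s"] qL by (auto simp: L2_seg_def)
    show "integrable (seg P) (\<lambda>s. \<delta>\<^sup>2)"
      using finite_measure.integrable_const[OF finite_measure_seg] by blast
    show "(cmod (h s - q s))\<^sup>2 \<le> \<delta>\<^sup>2" if "s \<in> space (seg P)" for s
      using q(2) that by (intro power_mono) (auto simp: space_restrict_space intro: less_imp_le)
  qed
  also have "\<dots> = \<delta>\<^sup>2 * P"
    using P by (simp add: measure_restrict_space space_restrict_space)
  finally have hq: "(\<integral>s. (cmod (h s - q s))\<^sup>2 \<partial>seg P) \<le> \<epsilon> / 4" using \<delta> by simp
  have "(\<integral>s. (cmod (f s - q s))\<^sup>2 \<partial>seg P) < \<epsilon>"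
    using L2_seg_diff_triangle[OF f hL qL] L2_seg_diff_triangle[OF f gL hL] g(3) h(3) hq by linarith
  then show ?thesis using F by blast
qed

theorem parseval:
  assumes P: "P > 0" and f: "f \<in> L2_seg P"
  shows "((\<lambda>n. (cmod (fourier_coeff P f n))\<^sup>2) has_sum P * (\<integral>s. (cmod (f s))\<^sup>2 \<partial>seg P)) UNIV"
proof -
  let ?c = "\<lambda>n. (cmod (fourier_coeff P f n))\<^sup>2"
  let ?I = "\<integral>s. (cmod (f s))\<^sup>2 \<partial>seg P"
  have up: "sum ?c F \<le> P * ?I" if "finite F" for F
  proof -
    have "0 \<le> (\<integral>s. (cmod (f s - trig_sum P (\<lambda>n. fourier_coeff P f n / P) F s))\<^sup>2 \<partial>seg P)"
      by simp
    also have "\<dots> = ?I - sum ?c F / P"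
      unfolding integral_trig_sum_diff_square[OF P that f] using P by simp
    finally show ?thesis using P by (simp add: field_simps)
  qed
  have summ: "?c summable_on UNIV"
    by (rule nonneg_bdd_above_summable_on) (auto intro!: bdd_aboveI[of _ "P * ?I"] up)
  have "infsum ?c UNIV \<le> P * ?I"
    by (rule infsum_le_finite_sums[OF summ]) (auto intro: up)
  moreover have "P * ?I \<le> infsum ?c UNIV + e" if "e > 0" for e
  proof -
    obtain F d where F: "finite F" "(\<integral>s. (cmod (f s - trig_sum P d F s))\<^sup>2 \<partial>seg P) < e / P"
      using trig_sum_dense[OF P f divide_pos_pos[OF \<open>e > 0\<close> P]] by blast
    have "0 \<le> (\<Sum>n\<in>F. (cmod (P * d n - fourier_coeff P f n))\<^sup>2) / P"
      using P by (simp add: sum_nonneg)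
    then have "?I - sum ?c F / P < e / P"
      using F(2) unfolding integral_trig_sum_diff_square[OF P F(1) f] by linarith
    then have "P * (?I - sum ?c F / P) < P * (e / P)"
      by (rule mult_strict_left_mono[OF _ P])
    moreover have "P * (?I - sum ?c F / P) = P * ?I - sum ?c F" "P * (e / P) = e"
      using P by (auto simp: right_diff_distrib)
    ultimately have "P * ?I < sum ?c F + e" by linarith
    also have "sum ?c F \<le> infsum ?c UNIV"
      by (rule finite_sum_le_infsum[OF summ F(1)]) auto
    finally show ?thesis by simp
  qed
  then have "P * ?I \<le> infsum ?c UNIV" by (rule field_le_epsilon)
  ultimately have "infsum ?c UNIV = P * ?I" by (rule antisym)
  with summ show ?thesis by (simp add: has_sum_iff)
qed

text \<open>Polarization of Parseval's identity. The lower frame bound comes from pairing two different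
sequences of coefficients, not from a single energy.\<close>

lemma parseval_Re:
  assumes P: "P > 0" and f: "f \<in> L2_seg P" and g: "g \<in> L2_seg P"
  shows "((\<lambda>n. Re (fourier_coeff P f n * cnj (fourier_coeff P g n))) has_sum
            P * (\<integral>s. Re (f s * cnj (g s)) \<partial>seg P)) UNIV"
proof -
  have mg: "(\<lambda>s. - g s) \<in> L2_seg P" using g by (auto simp: L2_seg_def)
  have d: "(\<lambda>s. f s - g s) \<in> L2_seg P" using L2_seg_add[OF f mg] by simp
  have id: "Re (a * cnj b) = ((cmod a)\<^sup>2 + (cmod b)\<^sup>2 - (cmod (a - b))\<^sup>2) / 2" for a b
    using two_Re_mult_cnj[of a b] by simp
  have fc: "fourier_coeff P (\<lambda>s. f s - g s) n = fourier_coeff P f n - fourier_coeff P g n" for n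
    unfolding fourier_coeff_def left_diff_distrib
    by (intro Bochner_Integration.integral_diff L2_seg_integrable_mult f g L2_seg_cnj harmonic_L2)
  have "((\<lambda>n. ((cmod (fourier_coeff P f n))\<^sup>2 + (cmod (fourier_coeff P g n))\<^sup>2
             - (cmod (fourier_coeff P (\<lambda>s. f s - g s) n))\<^sup>2) * (1 / 2)) has_sum
         (P * (\<integral>s. (cmod (f s))\<^sup>2 \<partial>seg P) + P * (\<integral>s. (cmod (g s))\<^sup>2 \<partial>seg P)
             - P * (\<integral>s. (cmod (f s - g s))\<^sup>2 \<partial>seg P)) * (1 / 2)) UNIV"
    unfolding diff_conv_add_uminus
    by (intro has_sum_cmult_left has_sum_add has_sum_uminusI)
       (use parseval[OF P f] parseval[OF P g] parseval[OF P d] in auto)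
  moreover have "(P * (\<integral>s. (cmod (f s))\<^sup>2 \<partial>seg P) + P * (\<integral>s. (cmod (g s))\<^sup>2 \<partial>seg P)
             - P * (\<integral>s. (cmod (f s - g s))\<^sup>2 \<partial>seg P)) * (1 / 2) = P * (\<integral>s. Re (f s * cnj (g s)) \<partial>seg P)"
    unfolding id using f g d by (simp add: L2_seg_def right_diff_distrib distrib_left)
  ultimately show ?thesis unfolding fc by (simp only: id) simp
qed

text \<open>Unconditional sums over the integers as limits of symmetric partial sums, the form in which
dominated convergence for sequences of functions applies.\<close>

lemma has_sum_int_LIMSEQ:
  fixes f :: "int \<Rightarrow> real"
  assumes "(f has_sum S) UNIV"
  shows "(\<lambda>N. \<Sum>n\<in>{- int N..int N}. f n) \<longlonglongrightarrow> S"
proof -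
  have "filterlim (\<lambda>N. {- int N..int N}) (finite_subsets_at_top UNIV) sequentially"
    unfolding filterlim_def le_filter_def eventually_filtermap
  proof safe
    fix Q :: "int set \<Rightarrow> bool"
    assume "eventually Q (finite_subsets_at_top UNIV)"
    then obtain X where X: "finite X" "\<And>Y. finite Y \<Longrightarrow> X \<subseteq> Y \<Longrightarrow> Q Y"
      by (auto simp: eventually_finite_subsets_at_top)
    obtain b where b: "\<And>x. x \<in> X \<Longrightarrow> \<bar>x\<bar> \<le> b"
      using X(1) by (metis finite_imageI Max_ge imageI)
    have "Q {- int N..int N}" if "N \<ge> nat b" for N
      using that b by (intro X) (auto, (force simp: abs_le_iff)+)
    then show "\<forall>\<^sub>F N in sequentially. Q {- int N..int N}"
      by (auto simp: eventually_sequentially)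
  qed
  then show ?thesis
    using assms unfolding has_sum_def by (rule filterlim_compose[rotated])
qed

lemma Re_mult_cnj_le:
  assumes "\<eta> > 0"
  shows "Re (a * cnj b) \<le> (\<eta> * (cmod a)\<^sup>2 + (cmod b)\<^sup>2 / \<eta>) / 2"
    and "\<bar>Re (a * cnj b)\<bar> \<le> ((cmod a)\<^sup>2 + (cmod b)\<^sup>2) / 2"
proof -
  have *: "\<bar>Re (a * cnj b)\<bar> \<le> cmod a * cmod b"
    using abs_Re_le_cmod[of "a * cnj b"] by (simp add: norm_mult)
  have "cmod a * cmod b \<le> (\<eta> * (cmod a)\<^sup>2 + (cmod b)\<^sup>2 / \<eta>) / 2" if "\<eta> > 0" for \<eta>
    using zero_le_power2[of "\<eta> * cmod a - cmod b"] that
    by (simp add: power2_diff field_simps power2_eq_square)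
  from this[OF assms] this[of 1] * 
  show "Re (a * cnj b) \<le> (\<eta> * (cmod a)\<^sup>2 + (cmod b)\<^sup>2 / \<eta>) / 2"
    "\<bar>Re (a * cnj b)\<bar> \<le> ((cmod a)\<^sup>2 + (cmod b)\<^sup>2) / 2" by auto
qed

section \<open>Exponential sums with frequencies in an arithmetic progression\<close>

text \<open>The finite sequence \<open>c\<close> of the introduction lives on the indices in \<open>K\<close>, and its exponential sum
\<open>p\<close> has the frequencies \<open>node k\<close>. Their common difference \<open>T\<close> makes the modulus of every such sum
periodic.\<close>

locale node_lattice =
  fixes T \<Lambda> x :: real and K :: "int set"
  assumes T: "T > 0" and K: "finite K" and \<Lambda>: "2 * pi / T \<le> \<Lambda>"
begin

definition period where "period = 2 * pi / T"
definition node where "node k = x + of_int k * T"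
definition node_sum where "node_sum d s = (\<Sum>k\<in>K. d k * cis (node k * s))"

lemma period_bounds: "period > 0" "period \<le> \<Lambda>" "\<Lambda> > 0"
proof -
  show "period > 0" using T by (simp add: period_def)
  moreover show "period \<le> \<Lambda>" using \<Lambda> by (simp add: period_def)
  ultimately show "\<Lambda> > 0" by linarith
qed

lemma node_sum_continuous: "continuous_on A (node_sum d)"
  unfolding node_sum_def cis_conv_exp by (intro continuous_intros)

lemma node_sum_measurable [measurable]: "node_sum d \<in> borel_measurable borel"
  by (intro borel_measurable_continuous_onI node_sum_continuous)

lemma node_sum_bound: "cmod (node_sum d s) \<le> (\<Sum>k\<in>K. cmod (d k))"
  unfolding node_sum_def by (rule order_trans[OF norm_sum]) (simp add: norm_mult)

lemma node_sum_L2: "node_sum d \<in> L2_seg P"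
  by (rule L2_seg_bounded[OF _ node_sum_bound]) simp

lemma node_sum_shift: "node_sum d (s + r) = node_sum (\<lambda>k. d k * cis (node k * r)) s"
  unfolding node_sum_def by (simp add: cis_mult algebra_simps)

text \<open>Orthogonality over \<open>N\<close> periods at once: the harmonic of index \<open>k\<close> for one period is the harmonic of index
\<open>N k\<close> for \<open>N\<close> periods.\<close>

lemma integral_node_sum:
  assumes "N > 0"
  shows "(\<integral>s. (cmod (node_sum d s))\<^sup>2 \<partial>seg (real N * period)) = real N * period * (\<Sum>k\<in>K. (cmod (d k))\<^sup>2)"
proof -
  let ?P = "real N * period"
  have P: "?P > 0" using assms period_bounds by simp
  have inj: "inj_on (\<lambda>k. int N * k) K" using assms by (auto intro: inj_onI)
  have "node_sum d s = cis (x * s) * trig_sum ?P (\<lambda>j. d (j div int N)) ((\<lambda>k. int N * k) ` K) s" for s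
    unfolding node_sum_def trig_sum_def sum.reindex[OF inj] sum_distrib_left
  proof (intro sum.cong refl)
    fix k
    have "2 * pi * real_of_int (int N * k) * s / ?P = of_int k * T * s"
      using assms T by (simp add: period_def field_simps)
    then show "d k * cis (node k * s) = cis (x * s) * 
        ((\<lambda>n. d (n div int N) * harmonic ?P n s) \<circ> (\<lambda>k. int N * k)) k"
      using assms by (simp add: harmonic_def cis_mult node_def algebra_simps)
  qed
  then have "(\<integral>s. (cmod (node_sum d s))\<^sup>2 \<partial>seg ?P)
     = (\<integral>s. (cmod (trig_sum ?P (\<lambda>j. d (j div int N)) ((\<lambda>k. int N * k) ` K) s))\<^sup>2 \<partial>seg ?P)"
    by (simp add: norm_mult)
  also have "\<dots> = ?P * (\<Sum>n\<in>(\<lambda>k. int N * k) ` K. (cmod (d (n div int N)))\<^sup>2)"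
    by (rule integral_trig_sum_square[OF P]) (use K in auto)
  also have "\<dots> = ?P * (\<Sum>k\<in>K. (cmod (d k))\<^sup>2)"
    using assms by (subst sum.reindex[OF inj]) simp
  finally show ?thesis .
qed

text \<open>The mean square over a period is unchanged by a shift \<open>r\<close>, because a shift only multiplies the
coefficients by numbers of modulus 1.\<close>

lemma integral_node_sum_period: "(\<integral>s. (cmod (node_sum d (s + r)))\<^sup>2 \<partial>seg period) = period * (\<Sum>k\<in>K. (cmod (d k))\<^sup>2)"
  using integral_node_sum[of 1 "\<lambda>k. d k * cis (node k * r)"] by (simp add: node_sum_shift norm_mult)

text \<open>The function \<open>u\<close> of the introduction is \<open>node_sum (resolvent_coeff c t)\<close>: summing the geometric
series in \<open>j\<close> for each frequency separately replaces the infinite series by a finite exponential sum.\<close>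

definition advance_factor where "advance_factor t k = exp ((\<i> * of_real (node k) - of_real t) * of_real \<Lambda>)"
definition resolvent_coeff where "resolvent_coeff c t k = c k / (1 - advance_factor t k)"

lemma norm_advance_factor: "cmod (advance_factor t k) = exp (- t * \<Lambda>)"
  by (simp add: advance_factor_def)

lemma advance_factor_neq_1: "t > 0 \<Longrightarrow> advance_factor t k \<noteq> 1"
  using norm_advance_factor[of t k] period_bounds by auto

lemma resolvent_functional_equation:
  assumes "t > 0"
  shows "node_sum (resolvent_coeff c t) s - of_real (exp (- t * \<Lambda>)) * node_sum (resolvent_coeff c t) (s + \<Lambda>) = node_sum c s"
  unfolding node_sum_shift unfolding node_sum_def sum_distrib_left sum_subtractf[symmetric]
proof (rule sum.cong[OF refl])
  fix k
  have "of_real (exp (- t * \<Lambda>)) * cis (node k * \<Lambda>) = advance_factor t k"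
    by (simp add: advance_factor_def cis_conv_exp exp_of_real[symmetric] exp_add[symmetric] algebra_simps)
  then have "resolvent_coeff c t k * cis (node k * s) - of_real (exp (- t * \<Lambda>)) * (resolvent_coeff c t k * cis (node k * \<Lambda>) * cis (node k * s))
     = resolvent_coeff c t k * (1 - advance_factor t k) * cis (node k * s)"
    unfolding right_diff_distrib left_diff_distrib by (simp add: mult_ac)
  then show "resolvent_coeff c t k * cis (node k * s) - of_real (exp (- t * \<Lambda>)) * (resolvent_coeff c t k * cis (node k * \<Lambda>) * cis (node k * s))
     = c k * cis (node k * s)"
    using advance_factor_neq_1[OF assms] by (simp add: resolvent_coeff_def)
qed

text \<open>The actors for a point mass at \<open>t\<close>: the window sums \<open>kernel_sum\<close> of that mass, the function on \<open>[0,\<Lambda>]\<close>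
whose Fourier coefficients are \<open>\<i>\<close> times these sums, and the function that supplies their partners in
the pairing.\<close>

definition kernel_sum where "kernel_sum c t m = (\<Sum>k\<in>K. c k / (of_real (node k - 2 * pi / \<Lambda> * of_int m) + \<i> * of_real t))"
definition kernel_symbol where "kernel_symbol c t s = of_real (exp (- t * s)) * node_sum (resolvent_coeff c t) s"
definition band_symbol where "band_symbol c s = indicator {0..period} s *\<^sub>R node_sum c s"

lemma kernel_symbol_L2:
  assumes "t \<ge> 0" shows "kernel_symbol c t \<in> L2_seg \<Lambda>"
  unfolding kernel_symbol_def by (rule L2_seg_mult_bounded[OF node_sum_L2, of _ _ 1]) (use assms in auto)

lemma band_symbol_L2: "band_symbol c \<in> L2_seg \<Lambda>"
  unfolding band_symbol_def
  by (rule L2_seg_bounded[of _ _ "\<Sum>k\<in>K. cmod (c k)"])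
     (use node_sum_bound in \<open>auto simp: indicator_def sum_nonneg\<close>)

text \<open>Integrating \<open>exp(z s)\<close> over \<open>[0,\<Lambda>]\<close> with \<open>z = i(y - 2\<pi>m/\<Lambda>) - t\<close> gives \<open>(exp(z\<Lambda>) - 1)/z\<close>, and
\<open>exp(z\<Lambda>)\<close> does not depend on \<open>m\<close>: it is the advance factor. The numerator therefore cancels against the
denominator of the resolvent coefficient.\<close>

lemma fourier_coeff_kernel_symbol:
  assumes t: "t > 0"
  shows "fourier_coeff \<Lambda> (kernel_symbol c t) m = \<i> * kernel_sum c t m"
proof -
  define z where "z k = \<i> * of_real (node k - 2 * pi / \<Lambda> * of_int m) - of_real t" for k
  have z: "z k \<noteq> 0" for k using t by (simp add: z_def complex_eq_iff)
  have expand: "kernel_symbol c t s * cnj (harmonic \<Lambda> m s) = (\<Sum>k\<in>K. resolvent_coeff c t k * exp (z k * of_real s))" for s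
    unfolding kernel_symbol_def node_sum_def sum_distrib_left sum_distrib_right
  proof (rule sum.cong[OF refl])
    fix k
    have "exp (z k * of_real s) = of_real (exp (- t * s)) * cis (node k * s) * cnj (harmonic \<Lambda> m s)"
      by (simp add: z_def harmonic_def cis_cnj cis_conv_exp exp_cnj exp_of_real[symmetric]
            exp_add[symmetric] algebra_simps)
    then show "of_real (exp (- t * s)) * (resolvent_coeff c t k * cis (node k * s)) * cnj (harmonic \<Lambda> m s) = 
       resolvent_coeff c t k * exp (z k * of_real s)" by simp
  qed
  have int1: "(\<integral>s. exp (z k * of_real s) \<partial>seg \<Lambda>) = (advance_factor t k - 1) / z k" for k
  proof -
    have "(\<integral>s. exp (z k * of_real s) \<partial>seg \<Lambda>) = exp (z k * of_real \<Lambda>) / z k - exp (z k * of_real 0) / z k"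
    proof (rule integral_seg_FTC)
      fix s
      have "((\<lambda>w. exp (z k * w) / z k) has_field_derivative exp (z k * of_real s)) (at (of_real s))"
        using z[of k] by (auto intro!: derivative_eq_intros)
      then show "((\<lambda>s. exp (z k * of_real s) / z k) has_vector_derivative exp (z k * of_real s)) (at s within {0..\<Lambda>})"
        by (rule has_vector_derivative_real_field[THEN has_vector_derivative_at_within])
    qed (use period_bounds in \<open>auto intro!: continuous_intros\<close>)
    also have "exp (z k * of_real \<Lambda>) = advance_factor t k * cis (2 * pi * of_int (- m))"
      using period_bounds by (simp add: z_def advance_factor_def cis_conv_exp exp_add[symmetric] algebra_simps)
    also have "cis (2 * pi * of_int (- m)) = 1" by (rule cis_multiple_2pi) simp
    finally show ?thesis by (simp add: diff_divide_distrib)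
  qed
  have int: "integrable (seg \<Lambda>) (\<lambda>s. resolvent_coeff c t k * exp (z k * of_real s))" for k
    using t by (intro integrable_mult_right integrable_seg_bounded[of _ _ 1]) (auto simp: z_def)
  have "fourier_coeff \<Lambda> (kernel_symbol c t) m = (\<Sum>k\<in>K. resolvent_coeff c t k * ((advance_factor t k - 1) / z k))"
    unfolding fourier_coeff_def expand
    by (subst Bochner_Integration.integral_sum[OF int]) (simp add: int1)
  also have "\<dots> = \<i> * kernel_sum c t m"
    unfolding kernel_sum_def sum_distrib_left
  proof (rule sum.cong[OF refl])
    fix k
    have "z k = \<i> * (of_real (node k - 2 * pi / \<Lambda> * of_int m) + \<i> * of_real t)"
      by (simp add: z_def algebra_simps)
    then show "resolvent_coeff c t k * ((advance_factor t k - 1) / z k) = \<i> * (c k / (of_real (node k - 2 * pi / \<Lambda> * of_int m) + \<i> * of_real t))"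
      using advance_factor_neq_1[OF t, of k] z[of k] unfolding resolvent_coeff_def by (simp add: divide_simps) (simp add: algebra_simps)
  qed
  finally show ?thesis .
qed

text \<open>The weight \<open>exp(-ts)\<close> is at most 1, the segment of length \<open>\<Lambda>\<close> is covered by \<open>\<lceil>\<Lambda> / period\<rceil>\<close>
periods, and \<open>|1 - advance_factor t k| \<ge> 1 - exp(-a\<Lambda>)\<close>. The bound is uniform in \<open>t \<ge> a\<close>, which is where the
distance of the measure from the real axis enters.\<close>

lemma kernel_sum_bessel:
  assumes a: "a > 0" "t \<ge> a"
  shows "(\<lambda>m. (cmod (kernel_sum c t m))\<^sup>2) summable_on UNIV"
    and "(\<Sum>\<^sub>\<infinity>m. (cmod (kernel_sum c t m))\<^sup>2)
        \<le> \<Lambda> * (nat \<lceil>\<Lambda> / period\<rceil> * period) / (1 - exp (- a * \<Lambda>))\<^sup>2 * (\<Sum>k\<in>K. (cmod (c k))\<^sup>2)"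
proof -
  have t: "t > 0" using a by simp
  define N where "N = nat \<lceil>\<Lambda> / period\<rceil>"
  have N0: "N > 0" using period_bounds by (simp add: N_def)
  have "\<Lambda> / period \<le> real N" unfolding N_def by (rule of_nat_ceiling)
  then have N: "\<Lambda> \<le> real N * period" using period_bounds by (simp add: field_simps)
  have hs: "((\<lambda>m. (cmod (kernel_sum c t m))\<^sup>2) has_sum \<Lambda> * (\<integral>s. (cmod (kernel_symbol c t s))\<^sup>2 \<partial>seg \<Lambda>)) UNIV"
    using parseval[OF period_bounds(3) kernel_symbol_L2, of t c] t by (simp add: fourier_coeff_kernel_symbol norm_mult)
  then show "(\<lambda>m. (cmod (kernel_sum c t m))\<^sup>2) summable_on UNIV" by (auto simp: has_sum_iff)
  have e: "0 < 1 - exp (- a * \<Lambda>)" using a period_bounds by simp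
  have "(\<integral>s. (cmod (kernel_symbol c t s))\<^sup>2 \<partial>seg \<Lambda>) \<le> (\<integral>s. (cmod (node_sum (resolvent_coeff c t) s))\<^sup>2 \<partial>seg (real N * period))"
  proof -
    have "integrable (seg (real N * period)) (\<lambda>s. (cmod (node_sum (resolvent_coeff c t) s))\<^sup>2)" "integrable (seg \<Lambda>) (\<lambda>s. (cmod (kernel_symbol c t s))\<^sup>2)"
      using node_sum_L2 kernel_symbol_L2[of t c] t by (auto simp: L2_seg_def)
    then show ?thesis
      unfolding integral_restrict_space[of "{0..\<Lambda>}" lborel, simplified] 
          integral_restrict_space[of "{0..real N * period}" lborel, simplified]
          integrable_restrict_space[of "{0..\<Lambda>}" lborel, simplified] 
          integrable_restrict_space[of "{0..real N * period}" lborel, simplified]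
      using N t
      by (intro integral_mono)
         (auto simp: indicator_def kernel_symbol_def norm_mult power_mult_distrib intro!: mult_left_le_one_le power_le_one)
  qed
  also have "\<dots> = real N * period * (\<Sum>k\<in>K. (cmod (resolvent_coeff c t k))\<^sup>2)"
    by (rule integral_node_sum[OF N0])
  also have "\<dots> \<le> real N * period * (\<Sum>k\<in>K. (cmod (c k))\<^sup>2 / (1 - exp (- a * \<Lambda>))\<^sup>2)"
  proof (intro mult_left_mono sum_mono)
    fix k
    have "exp (- t * \<Lambda>) \<le> exp (- a * \<Lambda>)" using a period_bounds by (simp add: mult_right_mono)
    moreover have "1 - cmod (advance_factor t k) \<le> cmod (1 - advance_factor t k)" using norm_triangle_ineq2[of 1 "advance_factor t k"] by simp
    ultimately have "1 - exp (- a * \<Lambda>) \<le> cmod (1 - advance_factor t k)" unfolding norm_advance_factor by linarith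
    then have "cmod (resolvent_coeff c t k) \<le> cmod (c k) / (1 - exp (- a * \<Lambda>))"
      unfolding resolvent_coeff_def norm_divide using e by (intro divide_left_mono mult_pos_pos) auto
    then have "(cmod (resolvent_coeff c t k))\<^sup>2 \<le> (cmod (c k) / (1 - exp (- a * \<Lambda>)))\<^sup>2" by (intro power_mono) auto
    then show "(cmod (resolvent_coeff c t k))\<^sup>2 \<le> (cmod (c k))\<^sup>2 / (1 - exp (- a * \<Lambda>))\<^sup>2" by (simp add: power_divide)
  qed (use period_bounds in auto)
  also have "\<dots> = real N * period / (1 - exp (- a * \<Lambda>))\<^sup>2 * (\<Sum>k\<in>K. (cmod (c k))\<^sup>2)"
    by (simp add: sum_divide_distrib[symmetric])
  finally have "\<Lambda> * (\<integral>s. (cmod (kernel_symbol c t s))\<^sup>2 \<partial>seg \<Lambda>) \<le> \<Lambda> * (real N * period / (1 - exp (- a * \<Lambda>))\<^sup>2 * (\<Sum>k\<in>K. (cmod (c k))\<^sup>2))"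
    using period_bounds by (intro mult_left_mono) auto
  then show "(\<Sum>\<^sub>\<infinity>m. (cmod (kernel_sum c t m))\<^sup>2)
        \<le> \<Lambda> * (nat \<lceil>\<Lambda> / period\<rceil> * period) / (1 - exp (- a * \<Lambda>))\<^sup>2 * (\<Sum>k\<in>K. (cmod (c k))\<^sup>2)"
    using hs by (simp add: has_sum_iff N_def mult.assoc)
qed

lemma integral_indicator_seg:
  fixes f :: "real \<Rightarrow> real"
  shows "(\<integral>s. indicator {0..period} s * f s \<partial>seg \<Lambda>) = (\<integral>s. f s \<partial>seg period)"
proof -
  have "indicator {0..\<Lambda>} s * (indicator {0..period} s * f s) = indicator {0..period} s * f s" for s
    using period_bounds by (auto simp: indicator_def)
  then have "(\<integral>s. indicator {0..\<Lambda>} s * (indicator {0..period} s * f s) \<partial>lborel)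
      = (\<integral>s. indicator {0..period} s * f s \<partial>lborel)" by (simp only:)
  then show ?thesis by (simp add: integral_restrict_space del: indicator_times_eq_if)
qed

lemma band_symbol_energy:
  "((\<lambda>m. (cmod (fourier_coeff \<Lambda> (band_symbol c) m))\<^sup>2) has_sum \<Lambda> * period * (\<Sum>k\<in>K. (cmod (c k))\<^sup>2)) UNIV"
proof -
  have "(cmod (band_symbol c s))\<^sup>2 = indicator {0..period} s * (cmod (node_sum c s))\<^sup>2" for s
    by (simp add: band_symbol_def indicator_def)
  then have "(\<integral>s. (cmod (band_symbol c s))\<^sup>2 \<partial>seg \<Lambda>) = period * (\<Sum>k\<in>K. (cmod (c k))\<^sup>2)"
    using integral_node_sum_period[of c 0] by (simp add: integral_indicator_seg)
  then show ?thesis using parseval[OF period_bounds(3) band_symbol_L2, of c] by (simp add: mult.assoc)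
qed

text \<open>The accretivity estimate at the heart of the lower bound: the pairing is positive for every \<open>t\<close>,
with a partner sequence that is the same for all \<open>t\<close>.\<close>

lemma pairing_lower:
  assumes t: "t > 0"
  shows "(\<lambda>m. Re (\<i> * kernel_sum c t m * cnj (fourier_coeff \<Lambda> (band_symbol c) m))) summable_on UNIV"
    and "(\<Sum>\<^sub>\<infinity>m. Re (\<i> * kernel_sum c t m * cnj (fourier_coeff \<Lambda> (band_symbol c) m)))
         \<ge> \<Lambda> * period * exp (- t * period) / 2 * (\<Sum>k\<in>K. (cmod (c k))\<^sup>2)"
proof -
  let ?E = "\<Sum>k\<in>K. (cmod (c k))\<^sup>2" and ?u = "node_sum (resolvent_coeff c t)"
  have hs: "((\<lambda>m. Re (\<i> * kernel_sum c t m * cnj (fourier_coeff \<Lambda> (band_symbol c) m))) has_sum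
     \<Lambda> * (\<integral>s. Re (kernel_symbol c t s * cnj (band_symbol c s)) \<partial>seg \<Lambda>)) UNIV"
    using parseval_Re[OF period_bounds(3) kernel_symbol_L2 band_symbol_L2, of t c c] t by (simp add: fourier_coeff_kernel_symbol)
  then show "(\<lambda>m. Re (\<i> * kernel_sum c t m * cnj (fourier_coeff \<Lambda> (band_symbol c) m))) summable_on UNIV"
    by (rule has_sum_imp_summable)
  have id: "2 * Re (?u s * cnj (node_sum c s)) = (cmod (?u s))\<^sup>2 + (cmod (node_sum c s))\<^sup>2 - exp (- 2 * t * \<Lambda>) * (cmod (?u (s + \<Lambda>)))\<^sup>2" for s
  proof -
    have "?u s - node_sum c s = of_real (exp (- t * \<Lambda>)) * ?u (s + \<Lambda>)"
      using resolvent_functional_equation[OF t, of c s] by (simp add: algebra_simps)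
    then have "(cmod (?u s - node_sum c s))\<^sup>2 = exp (- 2 * t * \<Lambda>) * (cmod (?u (s + \<Lambda>)))\<^sup>2"
      by (simp add: norm_mult power_mult_distrib exp_double[symmetric] mult.assoc)
    then show ?thesis using two_Re_mult_cnj[of "?u s" "node_sum c s"] by simp
  qed
  have i: "integrable (seg period) (\<lambda>s. (cmod (node_sum d (s + r)))\<^sup>2)" for d r
    unfolding node_sum_shift using node_sum_L2 by (auto simp: L2_seg_def)
  have iw: "integrable (seg period) (\<lambda>s. exp (- t * s) * (cmod (node_sum d (s + r)))\<^sup>2)" for d r
  proof (rule Bochner_Integration.integrable_bound[OF i[of d r]])
    show "AE s in seg period. norm (exp (- t * s) * (cmod (node_sum d (s + r)))\<^sup>2) \<le> norm ((cmod (node_sum d (s + r)))\<^sup>2)"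
      using t by (intro AE_I2) (auto simp: space_restrict_space intro!: mult_left_le_one_le)
  qed (auto intro!: measurable_segI)
  let ?A = "\<lambda>d r. \<integral>s. exp (- t * s) * (cmod (node_sum d (s + r)))\<^sup>2 \<partial>seg period"
  have lower: "exp (- t * period) * (period * (\<Sum>k\<in>K. (cmod (d k))\<^sup>2)) \<le> ?A d r" for d r
  proof -
    have "(\<integral>s. exp (- t * period) * (cmod (node_sum d (s + r)))\<^sup>2 \<partial>seg period) \<le> ?A d r"
      using i iw t by (intro integral_mono) (auto simp: space_restrict_space intro!: mult_right_mono mult_left_mono)
    then show ?thesis by (simp add: integral_node_sum_period)
  qed
  have upper: "?A d r \<le> period * (\<Sum>k\<in>K. (cmod (d k))\<^sup>2)" for d r
  proof -
    have "?A d r \<le> (\<integral>s. (cmod (node_sum d (s + r)))\<^sup>2 \<partial>seg period)"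
      using i iw t by (intro integral_mono) (auto simp: space_restrict_space intro!: mult_left_le_one_le)
    then show ?thesis by (simp add: integral_node_sum_period)
  qed
  \<comment> \<open>The shift does not change the unweighted mean square over a period, and the weight costs at most a factor exp (- t * period).\<close>
  have key: "exp (- 2 * t * \<Lambda>) * ?A (resolvent_coeff c t) \<Lambda> \<le> ?A (resolvent_coeff c t) 0"
  proof -
    have "period \<le> 2 * \<Lambda>" using period_bounds by linarith
    then have "t * period \<le> t * (2 * \<Lambda>)" using t by (intro mult_left_mono) auto
    then have "exp (- 2 * t * \<Lambda>) \<le> exp (- t * period)" by simp
    then have "exp (- 2 * t * \<Lambda>) * ?A (resolvent_coeff c t) \<Lambda> \<le> exp (- t * period) * (period * (\<Sum>k\<in>K. (cmod (resolvent_coeff c t k))\<^sup>2))"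
      using period_bounds by (intro mult_mono upper) (auto intro!: mult_nonneg_nonneg sum_nonneg Bochner_Integration.integral_nonneg)
    then show ?thesis using lower[of "resolvent_coeff c t" 0] by linarith
  qed
  have "(\<integral>s. Re (kernel_symbol c t s * cnj (band_symbol c s)) \<partial>seg \<Lambda>) = (\<integral>s. exp (- t * s) * Re (?u s * cnj (node_sum c s)) \<partial>seg period)"
  proof -
    have "Re (kernel_symbol c t s * cnj (band_symbol c s)) = indicator {0..period} s * (exp (- t * s) * Re (?u s * cnj (node_sum c s)))" for s
      by (simp add: kernel_symbol_def band_symbol_def indicator_def algebra_simps)
    then show ?thesis by (simp only: integral_indicator_seg)
  qed
  also have "\<dots> = (\<integral>s. (exp (- t * s) * (cmod (?u (s + 0)))\<^sup>2 + exp (- t * s) * (cmod (node_sum c (s + 0)))\<^sup>2 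
         - exp (- 2 * t * \<Lambda>) * (exp (- t * s) * (cmod (?u (s + \<Lambda>)))\<^sup>2)) / 2 \<partial>seg period)"
  proof (rule Bochner_Integration.integral_cong[OF refl])
    fix s
    show "exp (- t * s) * Re (?u s * cnj (node_sum c s)) = (exp (- t * s) * (cmod (?u (s + 0)))\<^sup>2 + exp (- t * s) * (cmod (node_sum c (s + 0)))\<^sup>2 
         - exp (- 2 * t * \<Lambda>) * (exp (- t * s) * (cmod (?u (s + \<Lambda>)))\<^sup>2)) / 2"
      using arg_cong[OF id[of s], of "\<lambda>z. exp (- t * s) * z"]
      by (simp only: add_0_right distrib_left right_diff_distrib) (simp add: mult_ac del: times_complex.sel)
  qed
  also have "\<dots> = (?A (resolvent_coeff c t) 0 + ?A c 0 - exp (- 2 * t * \<Lambda>) * ?A (resolvent_coeff c t) \<Lambda>) / 2"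
    using iw by (simp add: iw[of _ 0, simplified])
  also have "\<dots> \<ge> exp (- t * period) * (period * ?E) / 2"
  proof -
    have "Y / 2 \<le> (A + B - X) / 2" if "X \<le> A" "Y \<le> B" for X Y A B :: real
      using that by simp
    from this[OF key lower[of c 0]] show ?thesis .
  qed
  finally have "\<Lambda> * (exp (- t * period) * (period * ?E) / 2) \<le> \<Lambda> * (\<integral>s. Re (kernel_symbol c t s * cnj (band_symbol c s)) \<partial>seg \<Lambda>)"
    using period_bounds by (intro mult_left_mono) auto
  then show "(\<Sum>\<^sub>\<infinity>m. Re (\<i> * kernel_sum c t m * cnj (fourier_coeff \<Lambda> (band_symbol c) m))) \<ge> \<Lambda> * period * exp (- t * period) / 2 * ?E"
    using hs by (simp add: has_sum_iff mult_ac)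
qed

end

section \<open>Integration over the measure\<close>

text \<open>Cauchy-Schwarz against the constant function 1, read off from the nonnegative variance of
\<open>|f|\<close>.\<close>

lemma (in finite_measure) integral_square_le:
  fixes f :: "'a \<Rightarrow> complex"
  assumes f: "f \<in> borel_measurable M" and B: "\<And>x. x \<in> space M \<Longrightarrow> cmod (f x) \<le> B"
  shows "(cmod (\<integral>x. f x \<partial>M))\<^sup>2 \<le> measure M (space M) * (\<integral>x. (cmod (f x))\<^sup>2 \<partial>M)"
proof (cases "measure M (space M) = 0")
  case True
  then have "emeasure M (space M) = 0" by (simp add: emeasure_eq_measure)
  then have "AE x in M. f x = 0" by (intro AE_I[of _ _ "space M"]) auto
  then have "(\<integral>x. f x \<partial>M) = (\<integral>x. 0 \<partial>M)" by (intro integral_cong_AE) (use f in auto)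
  then show ?thesis using True by simp
next
  case False
  define V where "V = measure M (space M)"
  have V: "V > 0" using False measure_nonneg[of M "space M"] unfolding V_def by linarith
  have i1: "integrable M (\<lambda>x. cmod (f x))"
    by (rule integrable_const_bound[of _ B]) (use f B in \<open>auto intro!: AE_I2\<close>)
  have i2: "integrable M (\<lambda>x. (cmod (f x))\<^sup>2)"
    by (rule integrable_const_bound[of _ "B\<^sup>2"]) (use f B in \<open>auto intro!: AE_I2 power_mono\<close>)
  define m where "m = (\<integral>x. cmod (f x) \<partial>M)"
  have "0 \<le> (\<integral>x. (cmod (f x) - m / V)\<^sup>2 \<partial>M)" by simp
  also have "\<dots> = (\<integral>x. (cmod (f x))\<^sup>2 \<partial>M) - 2 * (m / V) * m + (m / V)\<^sup>2 * V"
    unfolding power2_diff using i1 i2 by (simp add: m_def V_def mult_ac)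
  finally have "m\<^sup>2 \<le> V * (\<integral>x. (cmod (f x))\<^sup>2 \<partial>M)"
    using V by (simp add: field_simps power2_eq_square)
  moreover have "(cmod (\<integral>x. f x \<partial>M))\<^sup>2 \<le> m\<^sup>2"
    unfolding m_def by (intro power_mono integral_norm_bound) auto
  ultimately show ?thesis by (simp add: V_def)
qed

text \<open>Interchange of an integral with a sum over the integers, for partial sums with an integrable
majorant. The terms may change sign, as they do in the pairing of \<open>pairing_lower\<close>.\<close>

lemma integral_int_sum_LIMSEQ:
  fixes f :: "int \<Rightarrow> 'a \<Rightarrow> real"
  assumes f: "\<And>m. integrable M (f m)"
    and sum: "\<And>x. x \<in> space M \<Longrightarrow> ((\<lambda>m. f m x) has_sum l x) UNIV"
    and w: "integrable M w" "\<And>x X. x \<in> space M \<Longrightarrow> finite X \<Longrightarrow> \<bar>\<Sum>m\<in>X. f m x\<bar> \<le> w x"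
  shows "integrable M l" "(\<lambda>N. \<Sum>m\<in>{- int N..int N}. \<integral>x. f m x \<partial>M) \<longlonglongrightarrow> (\<integral>x. l x \<partial>M)"
proof -
  let ?s = "\<lambda>N x. \<Sum>m\<in>{- int N..int N}. f m x"
  have [measurable]: "f m \<in> borel_measurable M" for m using f by blast
  have lim: "(\<lambda>N. ?s N x) \<longlonglongrightarrow> l x" if "x \<in> space M" for x
    by (rule has_sum_int_LIMSEQ[OF sum[OF that]])
  have l: "l \<in> borel_measurable M"
    by (rule borel_measurable_LIMSEQ_real[of _ ?s]) (use lim in auto)
  have dom: "AE x in M. norm (?s N x) \<le> w x" for N
    using w(2) by (intro AE_I2) auto
  have lim': "AE x in M. (\<lambda>N. ?s N x) \<longlonglongrightarrow> l x" using lim by (intro AE_I2)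
  show "integrable M l"
    by (rule integrable_dominated_convergence[OF l _ w(1) lim' dom]) measurable
  have "(\<lambda>N. \<integral>x. ?s N x \<partial>M) \<longlonglongrightarrow> (\<integral>x. l x \<partial>M)"
    by (rule integral_dominated_convergence[OF l _ w(1) lim' dom]) measurable
  then show "(\<lambda>N. \<Sum>m\<in>{- int N..int N}. \<integral>x. f m x \<partial>M) \<longlonglongrightarrow> (\<integral>x. l x \<partial>M)"
    using f by simp
qed

locale half_line_measure = finite_measure M for M :: "real measure" +
  fixes a :: real
  assumes a: "a > 0" and sets_M: "sets M = sets (restrict_space borel {a..})"
    and nonzero: "emeasure M {a..} \<noteq> 0"
begin

text \<open>\<open>conj_window\<close> is the complex conjugate of the window \<open>g\<close>; the conjugate is what enters the inner
products with the system.\<close>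

definition conj_window where "conj_window y = (\<integral>t. 1 / (complex_of_real y + \<i> * complex_of_real t) \<partial>M)"
definition mass where "mass = measure M (space M)"
definition laplace where "laplace L = (\<integral>t. exp (- t * L) \<partial>M)"

lemma mass_nonneg: "mass \<ge> 0"
  by (simp add: mass_def)

lemma space_M: "space M = {a..}"
  using sets_eq_imp_space_eq[OF sets_M] by (simp add: space_restrict_space)

lemma measurable_M: "f \<in> borel_measurable borel \<Longrightarrow> f \<in> borel_measurable M"
  using measurable_restrict_space1 measurable_cong_sets[OF sets_M refl] by blast

lemma integrable_M_bounded:
  fixes f :: "real \<Rightarrow> 'b::{banach,second_countable_topology}"
  assumes "f \<in> borel_measurable borel" "\<And>t. t \<ge> a \<Longrightarrow> norm (f t) \<le> B"
  shows "integrable M f"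
  by (rule integrable_const_bound[of _ B]) (use assms in \<open>auto simp: space_M measurable_M intro!: AE_I2\<close>)

lemma kernel_measurable [measurable]:
  "(\<lambda>t. c / (complex_of_real y + \<i> * complex_of_real t)) \<in> borel_measurable borel"
  by measurable

lemma kernel_bound:
  assumes "t \<ge> a"
  shows "cmod (1 / (complex_of_real y + \<i> * complex_of_real t)) \<le> 1 / sqrt (y\<^sup>2 + a\<^sup>2)"
proof -
  have "cmod (complex_of_real y + \<i> * complex_of_real t) = sqrt (y\<^sup>2 + t\<^sup>2)" by (simp add: cmod_def)
  moreover have "sqrt (y\<^sup>2 + a\<^sup>2) \<le> sqrt (y\<^sup>2 + t\<^sup>2)" using assms a by (simp add: power_mono)
  moreover have "0 < sqrt (y\<^sup>2 + a\<^sup>2)" using a by (simp add: add_nonneg_pos)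
  ultimately show ?thesis by (simp add: norm_divide frac_le)
qed

lemma kernel_integrable: "integrable M (\<lambda>t. 1 / (complex_of_real y + \<i> * complex_of_real t))"
  by (rule integrable_M_bounded[OF kernel_measurable kernel_bound])

lemma laplace_pos:
  assumes "L \<ge> 0" shows "laplace L > 0"
proof -
  have "(\<integral>t. 0 \<partial>M) < laplace L"
    unfolding laplace_def
  proof (rule integral_less_AE_space)
    show "integrable M (\<lambda>t. exp (- t * L))"
      by (rule integrable_M_bounded[of _ 1]) (use assms a in auto)
    show "emeasure M (space M) \<noteq> 0" using nonzero by (simp add: space_M)
  qed auto
  then show ?thesis by simp
qed

end

locale sampling = node_lattice + half_line_measure
begin

definition window_sum where "window_sum c m = (\<Sum>k\<in>K. c k * conj_window (node k - 2 * pi / \<Lambda> * of_int m))"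

definition bessel_const where
  "bessel_const = \<Lambda> * (nat \<lceil>\<Lambda> / period\<rceil> * period) / (1 - exp (- a * \<Lambda>))\<^sup>2"

lemma kernel_sum_measurable [measurable]: "(\<lambda>t. kernel_sum c t m) \<in> borel_measurable borel"
  unfolding kernel_sum_def by measurable

lemma integrable_kernel_sum: "integrable M (\<lambda>t. kernel_sum c t m)"
proof -
  have "integrable M (\<lambda>t. c k * (1 / (complex_of_real (node k - 2 * pi / \<Lambda> * of_int m) + \<i> * complex_of_real t)))" for k
    by (intro integrable_mult_right kernel_integrable)
  then show ?thesis unfolding kernel_sum_def by (intro Bochner_Integration.integrable_sum) simp
qed

lemma window_sum_eq_integral: "window_sum c m = (\<integral>t. kernel_sum c t m \<partial>M)"
proof -
  have "(\<integral>t. kernel_sum c t m \<partial>M) = (\<integral>t. (\<Sum>k\<in>K. c k * (1 / (complex_of_real (node k - 2 * pi / \<Lambda> * of_int m) + \<i> * complex_of_real t))) \<partial>M)"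
    by (simp add: kernel_sum_def)
  also have "\<dots> = window_sum c m"
    unfolding window_sum_def conj_window_def
    by (subst Bochner_Integration.integral_sum)
       (intro integrable_mult_right kernel_integrable, simp only: integral_mult_right_zero)
  finally show ?thesis by simp
qed

lemma kernel_sum_finite_sums:
  assumes "t \<ge> a" "finite X"
  shows "(\<Sum>m\<in>X. (cmod (kernel_sum c t m))\<^sup>2) \<le> bessel_const * (\<Sum>k\<in>K. (cmod (c k))\<^sup>2)"
  using finite_sum_le_infsum[OF kernel_sum_bessel(1)[OF a assms(1), of c] assms(2)] kernel_sum_bessel(2)[OF a assms(1), of c]
  by (simp add: bessel_const_def)

lemma kernel_sum_bounded:
  assumes "t \<ge> a"
  shows "cmod (kernel_sum c t m) \<le> sqrt (bessel_const * (\<Sum>k\<in>K. (cmod (c k))\<^sup>2))"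
  using kernel_sum_finite_sums[OF assms, of "{m}" c] by (simp add: real_le_rsqrt)

lemma integrable_kernel_sum_square: "integrable M (\<lambda>t. (cmod (kernel_sum c t m))\<^sup>2)"
  by (rule integrable_M_bounded[of _ "bessel_const * (\<Sum>k\<in>K. (cmod (c k))\<^sup>2)"])
     (use kernel_sum_finite_sums[of _ "{m}" c for m] in auto)

text \<open>Cauchy-Schwarz in \<open>t\<close>, followed by the bound for a single \<open>t\<close>, which is uniform on the support of
the measure.\<close>

lemma window_sum_finite_sums:
  assumes "finite X"
  shows "(\<Sum>m\<in>X. (cmod (window_sum c m))\<^sup>2) \<le> mass\<^sup>2 * bessel_const * (\<Sum>k\<in>K. (cmod (c k))\<^sup>2)"
proof -
  let ?B = "bessel_const * (\<Sum>k\<in>K. (cmod (c k))\<^sup>2)"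
  have "(\<Sum>m\<in>X. (cmod (window_sum c m))\<^sup>2) \<le> (\<Sum>m\<in>X. mass * (\<integral>t. (cmod (kernel_sum c t m))\<^sup>2 \<partial>M))"
    unfolding window_sum_eq_integral mass_def
    by (intro sum_mono integral_square_le[OF measurable_M kernel_sum_bounded]) (auto simp: space_M)
  also have "\<dots> = mass * (\<integral>t. (\<Sum>m\<in>X. (cmod (kernel_sum c t m))\<^sup>2) \<partial>M)"
    using integrable_kernel_sum_square by (simp add: sum_distrib_left)
  also have "(\<integral>t. (\<Sum>m\<in>X. (cmod (kernel_sum c t m))\<^sup>2) \<partial>M) \<le> (\<integral>t. ?B \<partial>M)"
    using integrable_kernel_sum_square assms kernel_sum_finite_sums by (intro integral_mono) (auto simp: space_M)
  also have "(\<integral>t. ?B \<partial>M) = mass * ?B" by (simp add: mass_def)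
  finally show ?thesis by (simp add: power2_eq_square mult.assoc mult_left_mono mass_nonneg)
qed

lemma window_sum_summable: "(\<lambda>m. (cmod (window_sum c m))\<^sup>2) summable_on UNIV"
  by (rule nonneg_bdd_above_summable_on)
     (auto intro!: bdd_aboveI[of _ "mass\<^sup>2 * bessel_const * (\<Sum>k\<in>K. (cmod (c k))\<^sup>2)"] window_sum_finite_sums)

lemma window_sum_upper: "(\<Sum>\<^sub>\<infinity>m. (cmod (window_sum c m))\<^sup>2) \<le> mass\<^sup>2 * bessel_const * (\<Sum>k\<in>K. (cmod (c k))\<^sup>2)"
  by (rule infsum_le_finite_sums[OF window_sum_summable window_sum_finite_sums])

text \<open>Integrate \<open>pairing_lower\<close> over \<open>t\<close>; the left side becomes the pairing of the window sums with the
coefficients \<open>w\<close>, whose energy is known. Cauchy-Schwarz is used in the form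
\<open>2 Re(z cnj w) \<le> \<eta>|z|\<^sup>2 + |w|\<^sup>2/\<eta>\<close> with \<open>\<eta> = 2 / laplace period\<close>, the value for which the \<open>w\<close> term absorbs exactly half
of the lower bound for the pairing.\<close>

lemma window_sum_lower: "\<Lambda> * period * (laplace period)\<^sup>2 / 4 * (\<Sum>k\<in>K. (cmod (c k))\<^sup>2) \<le> (\<Sum>\<^sub>\<infinity>m. (cmod (window_sum c m))\<^sup>2)"
proof -
  let ?E = "\<Sum>k\<in>K. (cmod (c k))\<^sup>2"
  define w where "w m = fourier_coeff \<Lambda> (band_symbol c) m" for m
  define f where "f m t = Re (\<i> * kernel_sum c t m * cnj (w m))" for m t
  define l where "l t = (\<Sum>\<^sub>\<infinity>m. f m t)" for t
  define total where "total = (\<Sum>\<^sub>\<infinity>m. (cmod (window_sum c m))\<^sup>2)"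
  have w_fin: "(\<Sum>m\<in>X. (cmod (w m))\<^sup>2) \<le> \<Lambda> * period * ?E" if "finite X" for X
    using finite_sum_le_has_sum[OF band_symbol_energy that, of c] by (simp add: w_def)
  have if': "integrable M (f m)" for m
    unfolding f_def by (intro integrable_Re integrable_mult_left integrable_mult_right integrable_kernel_sum)
  have hs: "((\<lambda>m. f m t) has_sum l t) UNIV" if "t \<in> space M" for t
    using pairing_lower(1)[of t c] that a unfolding l_def f_def w_def by (auto simp: space_M has_sum_iff)
  have dom: "\<bar>\<Sum>m\<in>X. f m t\<bar> \<le> (bessel_const * ?E + \<Lambda> * period * ?E) / 2" if "t \<in> space M" "finite X" for t X
  proof -
    have "\<bar>\<Sum>m\<in>X. f m t\<bar> \<le> (\<Sum>m\<in>X. ((cmod (\<i> * kernel_sum c t m))\<^sup>2 + (cmod (w m))\<^sup>2) / 2)"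
      unfolding f_def by (intro order_trans[OF sum_abs] sum_mono Re_mult_cnj_le(2)[of 1]) auto
    also have "\<dots> = ((\<Sum>m\<in>X. (cmod (kernel_sum c t m))\<^sup>2) + (\<Sum>m\<in>X. (cmod (w m))\<^sup>2)) / 2"
      by (simp add: norm_mult sum.distrib flip: sum_divide_distrib)
    also have "\<dots> \<le> (bessel_const * ?E + \<Lambda> * period * ?E) / 2"
      using kernel_sum_finite_sums[of t X c] w_fin that by (intro divide_right_mono add_mono) (auto simp: space_M)
    finally show ?thesis .
  qed
  have lim: "integrable M l" "(\<lambda>N. \<Sum>m\<in>{- int N..int N}. \<integral>t. f m t \<partial>M) \<longlonglongrightarrow> (\<integral>t. l t \<partial>M)"
    using integral_int_sum_LIMSEQ[OF if' hs _ dom] by auto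
  have "\<Lambda> * period / 2 * ?E * laplace period = (\<integral>t. \<Lambda> * period / 2 * ?E * exp (- t * period) \<partial>M)"
    by (simp add: laplace_def)
  also have "\<dots> \<le> (\<integral>t. l t \<partial>M)"
  proof (rule integral_mono)
    show "integrable M (\<lambda>t. \<Lambda> * period / 2 * ?E * exp (- t * period))"
      by (intro integrable_mult_right integrable_M_bounded[of _ 1]) (use a period_bounds in auto)
    show "\<Lambda> * period / 2 * ?E * exp (- t * period) \<le> l t" if "t \<in> space M" for t
      using pairing_lower(2)[of t c] that a unfolding l_def f_def w_def by (simp add: space_M mult_ac)
  qed (rule lim)
  finally have low: "\<Lambda> * period / 2 * ?E * laplace period \<le> (\<integral>t. l t \<partial>M)" .
  have laplace: "laplace period > 0" using laplace_pos period_bounds by simp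
  have "(\<integral>t. l t \<partial>M) \<le> total / laplace period + \<Lambda> * period * ?E * laplace period / 4"
  proof (rule LIMSEQ_le_const2[OF lim(2)], intro exI allI impI)
    fix N :: nat
    let ?X = "{- int N..int N}"
    have "(\<Sum>m\<in>?X. \<integral>t. f m t \<partial>M) = (\<Sum>m\<in>?X. Re (\<i> * window_sum c m * cnj (w m)))"
      unfolding f_def window_sum_eq_integral 
      by (intro sum.cong refl, subst integral_Re) (use integrable_kernel_sum in auto)
    also have "\<dots> \<le> (\<Sum>m\<in>?X. (2 / laplace period * (cmod (\<i> * window_sum c m))\<^sup>2 + (cmod (w m))\<^sup>2 / (2 / laplace period)) / 2)"
      by (intro sum_mono Re_mult_cnj_le(1)) (use laplace in auto)
    also have "\<dots> = (\<Sum>m\<in>?X. (cmod (window_sum c m))\<^sup>2) / laplace period + (\<Sum>m\<in>?X. (cmod (w m))\<^sup>2) * laplace period / 4"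
      by (simp add: norm_mult sum.distrib add_divide_distrib sum_divide_distrib sum_distrib_right)
    also have "\<dots> \<le> total / laplace period + \<Lambda> * period * ?E * laplace period / 4"
    proof (intro add_mono divide_right_mono mult_right_mono w_fin)
      show "(\<Sum>m\<in>?X. (cmod (window_sum c m))\<^sup>2) \<le> total"
        unfolding total_def by (rule finite_sum_le_infsum[OF window_sum_summable]) auto
    qed (use laplace in auto)
    finally show "(\<Sum>m\<in>?X. \<integral>t. f m t \<partial>M) \<le> total / laplace period + \<Lambda> * period * ?E * laplace period / 4" .
  qed
  then have upp: "(\<integral>t. l t \<partial>M) \<le> total / laplace period + (\<Lambda> * period * ?E * laplace period) / 4" by simp
  have low': "(\<Lambda> * period * ?E * laplace period) / 2 \<le> (\<integral>t. l t \<partial>M)" using low by simp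
  have "X / 4 \<le> Y" if "X / 2 \<le> I" "I \<le> Y + X / 4" for X Y I :: real
    using that by linarith
  from this[OF low' upp] have "\<Lambda> * period * ?E * laplace period / 4 \<le> total / laplace period" .
  then have "\<Lambda> * period * ?E * laplace period / 4 * laplace period \<le> total" using laplace by (simp add: pos_le_divide_eq)
  then show ?thesis unfolding total_def by (simp add: power2_eq_square mult_ac)
qed

end

section \<open>Reduction to functions of bounded support\<close>

lemma integral_fold_seg:
  fixes f :: "real \<Rightarrow> 'a::{banach,second_countable_topology}"
  assumes T: "T > 0" and f: "integrable lborel f"
    and supp: "\<And>x. x \<notin> {- real N * T..<real N * T} \<Longrightarrow> f x = 0"
  shows "(\<integral>x. f x \<partial>lborel) = (\<integral>x. (\<Sum>k\<in>{- int N..<int N}. f (x + of_int k * T)) \<partial>seg T)"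
    and "integrable (seg T) (\<lambda>x. f (x + of_int k * T))"
proof -
  let ?I = "\<lambda>k::int. {of_int k * T..<of_int k * T + T}"
  have shift: "integrable lborel (\<lambda>x. f (x + of_int k * T))" for k
    using lborel_integrable_real_affine[OF f, of 1 "of_int k * T"] by (simp add: add.commute)
  show i: "integrable (seg T) (\<lambda>x. f (x + of_int k * T))" for k
    using integrable_mult_indicator[OF _ shift, of "{0..T}"] by (simp add: integrable_restrict_space)
  have split: "f x = (\<Sum>k\<in>{- int N..<int N}. indicator (?I k) x *\<^sub>R f x)" for x
  proof -
    \<comment> \<open>The cells of length T are indexed by the integer part of x / T, so exactly one term survives.\<close>
    have mem: "x \<in> ?I k \<longleftrightarrow> k = \<lfloor>x / T\<rfloor>" for k
      unfolding eq_commute[of k] floor_eq_iff using T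
      by (simp add: pos_le_divide_eq pos_divide_less_eq distrib_right)
    have "(\<Sum>k\<in>{- int N..<int N}. indicator (?I k) x *\<^sub>R f x)
        = (\<Sum>k\<in>{- int N..<int N}. if k = \<lfloor>x / T\<rfloor> then f x else 0)"
    proof (intro sum.cong refl)
      fix k
      have "indicator (?I k) x *\<^sub>R f x = (if x \<in> ?I k then f x else 0)"
        by (simp add: indicator_def)
      then show "indicator (?I k) x *\<^sub>R f x = (if k = \<lfloor>x / T\<rfloor> then f x else 0)"
        unfolding mem .
    qed
    also have "\<dots> = (if \<lfloor>x / T\<rfloor> \<in> {- int N..<int N} then f x else 0)" by simp
    also have "\<dots> = f x"
    proof (cases "x \<in> {- real N * T..<real N * T}")
      case True
      then have "- real N \<le> x / T" "x / T < real N"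
        using T by (auto simp: pos_le_divide_eq pos_divide_less_eq)
      then have "\<lfloor>x / T\<rfloor> \<in> {- int N..<int N}"
        by (simp add: le_floor_iff floor_less_iff)
      then show ?thesis by simp
    qed (use supp[of x] in simp)
    finally show ?thesis by simp
  qed
  have one: "(\<integral>x. indicator (?I k) x *\<^sub>R f x \<partial>lborel) = (\<integral>x. f (x + of_int k * T) \<partial>seg T)" for k
  proof -
    have "(\<integral>x. indicator (?I k) x *\<^sub>R f x \<partial>lborel) = (\<integral>x. indicator {0..<T} x *\<^sub>R f (x + of_int k * T) \<partial>lborel)"
      by (subst lborel_integral_real_affine[of 1 _ "of_int k * T"])
         (auto simp: indicator_def add.commute intro!: Bochner_Integration.integral_cong)
    also have "\<dots> = (\<integral>x. indicator {0..T} x *\<^sub>R f (x + of_int k * T) \<partial>lborel)"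
    proof (rule integral_cong_AE)
      show "AE x in lborel. indicator {0..<T} x *\<^sub>R f (x + of_int k * T) = indicator {0..T} x *\<^sub>R f (x + of_int k * T)"
        using AE_lborel_singleton[of T] by eventually_elim (auto simp: indicator_def)
    qed (use shift[of k] in measurable)
    finally show ?thesis by (simp add: integral_restrict_space)
  qed
  have "(\<integral>x. f x \<partial>lborel) = (\<integral>x. (\<Sum>k\<in>{- int N..<int N}. indicator (?I k) x *\<^sub>R f x) \<partial>lborel)"
    using split by simp
  also have "\<dots> = (\<Sum>k\<in>{- int N..<int N}. \<integral>x. f (x + of_int k * T) \<partial>seg T)"
    by (subst Bochner_Integration.integral_sum) (auto simp: one intro!: integrable_mult_indicator f)
  also have "\<dots> = (\<integral>x. (\<Sum>k\<in>{- int N..<int N}. f (x + of_int k * T)) \<partial>seg T)"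
    using i by simp
  finally show "(\<integral>x. f x \<partial>lborel) = (\<integral>x. (\<Sum>k\<in>{- int N..<int N}. f (x + of_int k * T)) \<partial>seg T)" .
qed

lemma square_integrable_mult:
  assumes "f \<in> square_integrable" "g \<in> square_integrable"
  shows "integrable lborel (\<lambda>x. f x * cnj (g x))"
proof (rule Bochner_Integration.integrable_bound)
  have [measurable]: "f \<in> borel_measurable lborel" "g \<in> borel_measurable lborel"
    using assms by (auto simp: square_integrable_def)
  show "integrable lborel (\<lambda>s. (cmod (f s))\<^sup>2 + (cmod (g s))\<^sup>2)"
    using assms by (auto simp: square_integrable_def)
  show "AE s in lborel. norm (f s * cnj (g s)) \<le> norm ((cmod (f s))\<^sup>2 + (cmod (g s))\<^sup>2)"
  proof (intro AE_I2)
    fix s show "norm (f s * cnj (g s)) \<le> norm ((cmod (f s))\<^sup>2 + (cmod (g s))\<^sup>2)"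
      using cmod_mult_le_sum_squares[of "f s" "cnj (g s)"] by simp
  qed
  show "(\<lambda>s. f s * cnj (g s)) \<in> borel_measurable lborel" by measurable
qed

lemma norm_L2_square: "(norm_L2 h)\<^sup>2 = (\<integral>x. (cmod (h x))\<^sup>2 \<partial>lborel)"
  by (simp add: norm_L2_def)

lemma square_integrable_cutoff:
  assumes "h \<in> square_integrable" "S \<in> sets borel"
  shows "(\<lambda>x. indicator S x *\<^sub>R h x) \<in> square_integrable"
proof -
  have [measurable]: "h \<in> borel_measurable borel" using assms by (auto simp: square_integrable_def)
  have "(cmod (indicator S x *\<^sub>R h x))\<^sup>2 = indicator S x *\<^sub>R (cmod (h x))\<^sup>2" for x
    by (simp add: indicator_def)
  then show ?thesis using assms integrable_mult_indicator[of S lborel "\<lambda>x. (cmod (h x))\<^sup>2"]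
    by (auto simp: square_integrable_def)
qed

text \<open>Truncate \<open>h\<close> to growing intervals. Every single coefficient converges, so the upper bound passes to the
limit in finite partial sums. With the upper bound known for all functions, the coefficients of the
remainder \<open>r N\<close> have small energy, and \<open>|x+y|\<^sup>2 \<le> 2|x|\<^sup>2 + 2|y|\<^sup>2\<close> transfers the lower bound at the price of a
factor 2.\<close>

lemma is_frame_L2_from_bounded_support:
  fixes f :: "'i \<Rightarrow> real \<Rightarrow> complex"
  assumes T: "T > 0" and A: "A > 0" and B: "B > 0" and f: "\<And>i. f i \<in> square_integrable"
    and fr: "\<And>h N. h \<in> square_integrable \<Longrightarrow> (\<And>x. x \<notin> {- real N * T..<real N * T} \<Longrightarrow> h x = 0) \<Longrightarrow>
        (\<lambda>i. (cmod (ip_L2 h (f i)))\<^sup>2) summable_on UNIV \<and>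
        A * (norm_L2 h)\<^sup>2 \<le> (\<Sum>\<^sub>\<infinity>i. (cmod (ip_L2 h (f i)))\<^sup>2) \<and>
        (\<Sum>\<^sub>\<infinity>i. (cmod (ip_L2 h (f i)))\<^sup>2) \<le> B * (norm_L2 h)\<^sup>2"
  shows "is_frame_L2 f"
proof -
  define cut where "cut N h x = indicator {- real N * T..<real N * T} x *\<^sub>R h x" for N and h :: "real \<Rightarrow> complex" and x
  have cut: "cut N h \<in> square_integrable" if "h \<in> square_integrable" for N h
    using square_integrable_cutoff[OF that] unfolding cut_def by simp
  have ev: "eventually (\<lambda>N. cut N h x = h x) sequentially" for h x
  proof -
    obtain n0 :: nat where n0: "\<bar>x\<bar> / T < real n0" using reals_Archimedean2 by blast
    have "cut N h x = h x" if "N \<ge> n0" for N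
    proof -
      have "\<bar>x\<bar> / T < real N" using n0 that by linarith
      then have "\<bar>x\<bar> < real N * T" using T by (simp add: field_simps)
      then show ?thesis by (auto simp: cut_def indicator_def)
    qed
    then show ?thesis by (auto simp: eventually_sequentially)
  qed
  have cut_le: "cmod (cut N h x) \<le> cmod (h x)" for N h x
    by (simp add: cut_def indicator_def)
  have cut_fr: "(\<lambda>i. (cmod (ip_L2 (cut N h) (f i)))\<^sup>2) summable_on UNIV"
     "A * (norm_L2 (cut N h))\<^sup>2 \<le> (\<Sum>\<^sub>\<infinity>i. (cmod (ip_L2 (cut N h) (f i)))\<^sup>2)"
     "(\<Sum>\<^sub>\<infinity>i. (cmod (ip_L2 (cut N h) (f i)))\<^sup>2) \<le> B * (norm_L2 (cut N h))\<^sup>2"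
    if "h \<in> square_integrable" for h N
    using fr[OF cut[OF that], of N N] by (auto simp: cut_def)
  have meas: "h \<in> borel_measurable borel" if "h \<in> square_integrable" for h
    using that by (auto simp: square_integrable_def)
  have norm_le: "(norm_L2 (cut N h))\<^sup>2 \<le> (norm_L2 h)\<^sup>2" if "h \<in> square_integrable" for h N
    unfolding norm_L2_square using cut[OF that, of N] that cut_le
    by (intro integral_mono) (auto simp: square_integrable_def power_mono)
  have ip_lim: "(\<lambda>N. ip_L2 (cut N h) (f i)) \<longlonglongrightarrow> ip_L2 h (f i)" if h: "h \<in> square_integrable" for h i
    unfolding ip_L2_def
  proof (rule integral_dominated_convergence[where w = "\<lambda>x. cmod (h x * cnj (f i x))"])
    show "integrable lborel (\<lambda>x. cmod (h x * cnj (f i x)))"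
      by (intro integrable_norm square_integrable_mult h f)
    show "AE x in lborel. (\<lambda>N. cut N h x * cnj (f i x)) \<longlonglongrightarrow> h x * cnj (f i x)"
      by (intro AE_I2 tendsto_intros tendsto_eventually ev)
    show "AE x in lborel. norm (cut N h x * cnj (f i x)) \<le> cmod (h x * cnj (f i x))" for N
      using cut_le by (auto simp: norm_mult intro!: mult_right_mono)
  qed (use meas[OF h] meas[OF f] meas[OF cut[OF h]] in measurable)
  have fin: "(\<Sum>i\<in>X. (cmod (ip_L2 h (f i)))\<^sup>2) \<le> B * (norm_L2 h)\<^sup>2" if h: "h \<in> square_integrable" and X: "finite X" for h X
  proof (rule LIMSEQ_le_const2)
    show "(\<lambda>N. \<Sum>i\<in>X. (cmod (ip_L2 (cut N h) (f i)))\<^sup>2) \<longlonglongrightarrow> (\<Sum>i\<in>X. (cmod (ip_L2 h (f i)))\<^sup>2)"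
      by (intro tendsto_intros ip_lim h)
    show "\<exists>n0. \<forall>N\<ge>n0. (\<Sum>i\<in>X. (cmod (ip_L2 (cut N h) (f i)))\<^sup>2) \<le> B * (norm_L2 h)\<^sup>2"
    proof (intro exI allI impI)
      fix N
      have "(\<Sum>i\<in>X. (cmod (ip_L2 (cut N h) (f i)))\<^sup>2) \<le> (\<Sum>\<^sub>\<infinity>i. (cmod (ip_L2 (cut N h) (f i)))\<^sup>2)"
        by (rule finite_sum_le_infsum[OF cut_fr(1)[OF h] X]) auto
      also have "\<dots> \<le> B * (norm_L2 (cut N h))\<^sup>2" by (rule cut_fr(3)[OF h])
      also have "\<dots> \<le> B * (norm_L2 h)\<^sup>2" using norm_le[OF h] B by (intro mult_left_mono) auto
      finally show "(\<Sum>i\<in>X. (cmod (ip_L2 (cut N h) (f i)))\<^sup>2) \<le> B * (norm_L2 h)\<^sup>2" .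
    qed
  qed
  have summ: "(\<lambda>i. (cmod (ip_L2 h (f i)))\<^sup>2) summable_on UNIV" if h: "h \<in> square_integrable" for h
    by (rule nonneg_bdd_above_summable_on) (auto intro!: bdd_aboveI[of _ "B * (norm_L2 h)\<^sup>2"] fin[OF h])
  have upper: "(\<Sum>\<^sub>\<infinity>i. (cmod (ip_L2 h (f i)))\<^sup>2) \<le> B * (norm_L2 h)\<^sup>2" if h: "h \<in> square_integrable" for h
    by (rule infsum_le_finite_sums[OF summ[OF h] fin[OF h]])
  have lower: "A / 2 * (norm_L2 h)\<^sup>2 \<le> (\<Sum>\<^sub>\<infinity>i. (cmod (ip_L2 h (f i)))\<^sup>2)" if h: "h \<in> square_integrable" for h
  proof -
    define r where "r N x = h x - cut N h x" for N x
    have r_cut: "r N = (\<lambda>x. indicator (- {- real N * T..<real N * T}) x *\<^sub>R h x)" for N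
      by (auto simp: r_def cut_def indicator_def)
    have r: "r N \<in> square_integrable" for N
      unfolding r_cut by (rule square_integrable_cutoff[OF h]) auto
    have r_le: "cmod (r N x) \<le> cmod (h x)" for N x
      by (simp add: r_cut indicator_def)
    have ih: "integrable lborel (\<lambda>x. (cmod (h x))\<^sup>2)" using h by (simp add: square_integrable_def)
    have lim1: "(\<lambda>N. (norm_L2 (cut N h))\<^sup>2) \<longlonglongrightarrow> (norm_L2 h)\<^sup>2"
      unfolding norm_L2_square
    proof (rule integral_dominated_convergence[OF _ _ ih])
      show "AE x in lborel. (\<lambda>N. (cmod (cut N h x))\<^sup>2) \<longlonglongrightarrow> (cmod (h x))\<^sup>2"
        by (intro AE_I2 tendsto_intros tendsto_eventually ev)
      show "AE x in lborel. norm ((cmod (cut N h x))\<^sup>2) \<le> (cmod (h x))\<^sup>2" for N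
        using cut_le by (auto intro: power_mono)
    qed (use meas[OF h] meas[OF cut[OF h]] in measurable)
    have "(\<lambda>N. (norm_L2 (r N))\<^sup>2) \<longlonglongrightarrow> (\<integral>x. 0 \<partial>(lborel :: real measure))"
      unfolding norm_L2_square
    proof (rule integral_dominated_convergence[OF _ _ ih])
      have "eventually (\<lambda>N. (cmod (r N x))\<^sup>2 = 0) sequentially" for x
        using ev[of h x] by eventually_elim (simp add: r_def)
      then show "AE x in lborel. (\<lambda>N. (cmod (r N x))\<^sup>2) \<longlonglongrightarrow> 0"
        by (intro AE_I2 tendsto_eventually)
      show "AE x in lborel. norm ((cmod (r N x))\<^sup>2) \<le> (cmod (h x))\<^sup>2" for N
        using r_le by (auto intro: power_mono)
    qed (use meas[OF r] in measurable)
    then have lim2: "(\<lambda>N. (norm_L2 (r N))\<^sup>2) \<longlonglongrightarrow> 0" by simp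
    let ?S = "\<lambda>h. \<Sum>\<^sub>\<infinity>i. (cmod (ip_L2 h (f i)))\<^sup>2"
    have "A * (norm_L2 (cut N h))\<^sup>2 \<le> 2 * ?S h + 2 * (B * (norm_L2 (r N))\<^sup>2)" for N
    proof -
      have ip: "ip_L2 (cut N h) (f i) = ip_L2 h (f i) + - ip_L2 (r N) (f i)" for i
      proof -
        have "ip_L2 (cut N h) (f i) = (\<integral>x. h x * cnj (f i x) - r N x * cnj (f i x) \<partial>lborel)"
          unfolding ip_L2_def r_def by (simp add: algebra_simps)
        also have "\<dots> = ip_L2 h (f i) - ip_L2 (r N) (f i)"
          unfolding ip_L2_def by (intro Bochner_Integration.integral_diff square_integrable_mult h f r)
        finally show ?thesis by simp
      qed
      have "A * (norm_L2 (cut N h))\<^sup>2 \<le> ?S (cut N h)" by (rule cut_fr(2)[OF h])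
      also have "\<dots> \<le> (\<Sum>\<^sub>\<infinity>i. 2 * (cmod (ip_L2 h (f i)))\<^sup>2 + 2 * (cmod (ip_L2 (r N) (f i)))\<^sup>2)"
      proof (rule infsum_mono)
        show "(\<lambda>i. 2 * (cmod (ip_L2 h (f i)))\<^sup>2 + 2 * (cmod (ip_L2 (r N) (f i)))\<^sup>2) summable_on UNIV"
          by (intro summable_on_add summable_on_cmult_right summ h r)
        show "(cmod (ip_L2 (cut N h) (f i)))\<^sup>2 \<le> 2 * (cmod (ip_L2 h (f i)))\<^sup>2 + 2 * (cmod (ip_L2 (r N) (f i)))\<^sup>2" for i
          using cmod_add_square_le[of "ip_L2 h (f i)" "- ip_L2 (r N) (f i)"] unfolding ip by simp
      qed (rule cut_fr(1)[OF h])
      also have "\<dots> = 2 * ?S h + 2 * ?S (r N)"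
        by (simp only: infsum_add[OF summable_on_cmult_right[OF summ[OF h]] summable_on_cmult_right[OF summ[OF r]]]
              infsum_cmult_right')
      also have "\<dots> \<le> 2 * ?S h + 2 * (B * (norm_L2 (r N))\<^sup>2)" using upper[OF r] by simp
      finally show ?thesis .
    qed
    note ineq = this
    have l1: "(\<lambda>N. A * (norm_L2 (cut N h))\<^sup>2) \<longlonglongrightarrow> A * (norm_L2 h)\<^sup>2"
      by (intro tendsto_intros lim1)
    have l2: "(\<lambda>N. 2 * ?S h + 2 * (B * (norm_L2 (r N))\<^sup>2)) \<longlonglongrightarrow> 2 * ?S h + 2 * (B * 0)"
      by (intro tendsto_intros lim2)
    have "A * (norm_L2 h)\<^sup>2 \<le> 2 * ?S h + 2 * (B * 0)"
      by (rule LIMSEQ_le[OF l1 l2]) (use ineq in blast)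
    then show ?thesis by simp
  qed
  have "\<forall>h\<in>square_integrable. (\<lambda>i. (cmod (ip_L2 h (f i)))\<^sup>2) summable_on UNIV \<and>
        A / 2 * (norm_L2 h)\<^sup>2 \<le> (\<Sum>\<^sub>\<infinity>i. (cmod (ip_L2 h (f i)))\<^sup>2) \<and>
        (\<Sum>\<^sub>\<infinity>i. (cmod (ip_L2 h (f i)))\<^sup>2) \<le> B * (norm_L2 h)\<^sup>2"
    by (intro ballI conjI summ lower upper)
  then have "\<exists>A>0. \<exists>B>0. \<forall>h\<in>square_integrable. (\<lambda>i. (cmod (ip_L2 h (f i)))\<^sup>2) summable_on UNIV \<and>
        A * (norm_L2 h)\<^sup>2 \<le> (\<Sum>\<^sub>\<infinity>i. (cmod (ip_L2 h (f i)))\<^sup>2) \<and>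
        (\<Sum>\<^sub>\<infinity>i. (cmod (ip_L2 h (f i)))\<^sup>2) \<le> B * (norm_L2 h)\<^sup>2"
    using half_gt_zero[OF A] B by (intro exI conjI)
  then show ?thesis
    unfolding is_frame_L2_def using f by simp
qed

section \<open>The Gabor system\<close>

context half_line_measure
begin

lemma conj_window_measurable [measurable]: "conj_window \<in> borel_measurable borel"
proof -
  have "(\<lambda>t. t) \<in> borel_measurable M" by (rule measurable_M) simp
  then have [measurable]: "snd \<in> borel_measurable ((borel :: real measure) \<Otimes>\<^sub>M M)"
    using measurable_compose[OF measurable_snd] by blast
  have "(\<lambda>(y, t). 1 / (complex_of_real y + \<i> * complex_of_real t)) \<in> borel_measurable ((borel :: real measure) \<Otimes>\<^sub>M M)"
    unfolding case_prod_beta by measurable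
  then show ?thesis unfolding conj_window_def by (rule borel_measurable_lebesgue_integral)
qed

lemma conj_window_bound: "cmod (conj_window y) \<le> mass / sqrt (y\<^sup>2 + a\<^sup>2)"
proof -
  have "cmod (conj_window y) \<le> (\<integral>t. cmod (1 / (complex_of_real y + \<i> * complex_of_real t)) \<partial>M)"
    unfolding conj_window_def by (rule integral_norm_bound)
  also have "\<dots> \<le> (\<integral>t. 1 / sqrt (y\<^sup>2 + a\<^sup>2) \<partial>M)"
    using kernel_bound by (intro integral_mono integrable_norm kernel_integrable) (auto simp: space_M)
  also have "\<dots> = mass / sqrt (y\<^sup>2 + a\<^sup>2)" by (simp add: mass_def)
  finally show ?thesis .
qed

lemma conj_window_bounded: "cmod (conj_window y) \<le> mass / a"
proof -
  have "a \<le> sqrt (y\<^sup>2 + a\<^sup>2)" using a by (intro real_le_rsqrt) simp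
  then have "mass / sqrt (y\<^sup>2 + a\<^sup>2) \<le> mass / a"
    using a mass_nonneg by (intro divide_left_mono mult_pos_pos) (auto intro: add_nonneg_pos)
  with conj_window_bound[of y] show ?thesis by linarith
qed

lemma conj_window_square_integrable: "conj_window \<in> square_integrable"
proof -
  define b where "b = min 1 (a\<^sup>2)"
  have b: "b > 0" "b \<le> 1" "b \<le> a\<^sup>2" using a by (auto simp: b_def)
  have "integrable lborel (\<lambda>x. (cmod (conj_window x))\<^sup>2)"
  proof (rule Bochner_Integration.integrable_bound)
    show "integrable lborel (\<lambda>x::real. mass\<^sup>2 / b * inverse (1 + x\<^sup>2))"
      using integrable_inverse_1_plus_square by (intro integrable_mult_right) (simp add: set_integrable_def)
    show "AE x in lborel. norm ((cmod (conj_window x))\<^sup>2) \<le> norm (mass\<^sup>2 / b * inverse (1 + x\<^sup>2))"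
    proof (intro AE_I2)
      fix x :: real
      have "b * (1 + x\<^sup>2) \<le> x\<^sup>2 + a\<^sup>2"
        using b mult_right_mono[OF b(2), of "x\<^sup>2"] by (simp add: distrib_left)
      moreover have "0 < b * (1 + x\<^sup>2)" using b by (intro mult_pos_pos) (auto simp: add_pos_nonneg)
      ultimately have "mass\<^sup>2 / (x\<^sup>2 + a\<^sup>2) \<le> mass\<^sup>2 / (b * (1 + x\<^sup>2))"
        by (intro divide_left_mono) (auto intro: mult_pos_pos less_le_trans)
      moreover have "(cmod (conj_window x))\<^sup>2 \<le> (mass / sqrt (x\<^sup>2 + a\<^sup>2))\<^sup>2"
        by (intro power_mono conj_window_bound) auto
      then have "(cmod (conj_window x))\<^sup>2 \<le> mass\<^sup>2 / (x\<^sup>2 + a\<^sup>2)"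
        by (simp add: power_divide)
      ultimately show "norm ((cmod (conj_window x))\<^sup>2) \<le> norm (mass\<^sup>2 / b * inverse (1 + x\<^sup>2))"
        using b by (simp add: power_divide divide_inverse mult_ac)
    qed
  qed simp
  then show ?thesis by (simp add: square_integrable_def)
qed

end

lemma time_freq_shift_square_integrable:
  assumes "g \<in> square_integrable"
  shows "time_freq_shift t \<omega> g \<in> square_integrable"
proof -
  have g: "g \<in> borel_measurable borel" "integrable lborel (\<lambda>x. (cmod (g x))\<^sup>2)"
    using assms by (auto simp: square_integrable_def)
  note [measurable] = g(1)
  have "integrable lborel (\<lambda>x. (cmod (g (- t + 1 * x)))\<^sup>2)"
    using lborel_integrable_real_affine[OF g(2), of 1 "-t"] by simp
  moreover have "time_freq_shift t \<omega> g \<in> borel_measurable borel"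
    unfolding time_freq_shift_def by measurable
  moreover have "cmod (time_freq_shift t \<omega> g x) = cmod (g (- t + 1 * x))" for x
    by (simp add: time_freq_shift_def norm_mult)
  ultimately show ?thesis by (simp add: square_integrable_def)
qed

text \<open>Modulation by \<open>\<beta>n\<close> is invariant under translation by \<open>1/\<beta>\<close>, so folding the line onto one segment of this
length turns the inner product into a Fourier coefficient on the segment.\<close>

lemma ip_L2_gabor_system:
  assumes \<beta>: "\<beta> > 0" and h: "h \<in> square_integrable" and g: "g \<in> square_integrable"
    and supp: "\<And>x. x \<notin> {- real N * (1 / \<beta>)..<real N * (1 / \<beta>)} \<Longrightarrow> h x = 0"
  shows "ip_L2 h (gabor_system g \<alpha> \<beta> (m, n))
     = fourier_coeff (1 / \<beta>) (\<lambda>x. \<Sum>k\<in>{- int N..<int N}.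
          h (x + of_int k * (1 / \<beta>)) * cnj (g (x + of_int k * (1 / \<beta>) - \<alpha> * of_int m))) n"
proof -
  let ?T = "1 / \<beta>"
  let ?f = "\<lambda>x. h x * cnj (time_freq_shift (\<alpha> * of_int m) (\<beta> * of_int n) g x)"
  have f: "integrable lborel ?f"
    by (intro square_integrable_mult h time_freq_shift_square_integrable g)
  have "ip_L2 h (gabor_system g \<alpha> \<beta> (m, n)) = (\<integral>x. ?f x \<partial>lborel)"
    by (simp add: ip_L2_def gabor_system_def)
  also have "\<dots> = (\<integral>x. (\<Sum>k\<in>{- int N..<int N}. ?f (x + of_int k * ?T)) \<partial>seg ?T)"
    by (rule integral_fold_seg(1)[OF _ f]) (use \<beta> supp in auto)
  also have "\<dots> = fourier_coeff (1 / \<beta>) (\<lambda>x. \<Sum>k\<in>{- int N..<int N}.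
          h (x + of_int k * ?T) * cnj (g (x + of_int k * ?T - \<alpha> * of_int m))) n"
    unfolding fourier_coeff_def sum_distrib_right
  proof (intro Bochner_Integration.integral_cong refl sum.cong)
    fix x k
    have arg: "2 * pi * of_int n * x / ?T + 2 * pi * of_int (n * k)
        = 2 * pi * (\<beta> * of_int n) * (x + of_int k * ?T)"
      using \<beta> by (simp add: distrib_left)
    have "exp (2 * of_real pi * \<i> * of_real (\<beta> * of_int n) * of_real (x + of_int k * ?T))
        = harmonic ?T n x * cis (2 * pi * of_int (n * k))"
      unfolding harmonic_def cis_mult arg by (simp add: cis_conv_exp mult_ac)
    also have "cis (2 * pi * of_int (n * k)) = 1" by (rule cis_multiple_2pi) simp
    finally show "?f (x + of_int k * ?T) = h (x + of_int k * ?T) *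
         cnj (g (x + of_int k * ?T - \<alpha> * of_int m)) * cnj (harmonic ?T n x)"
      by (simp add: time_freq_shift_def)
  qed
  finally show ?thesis .
qed

theorem corollary1p2:
  fixes a \<alpha> \<beta> :: real and \<mu> :: "real measure" and g :: "real \<Rightarrow> complex"
  assumes "a > 0"
    and "sets \<mu> = sets (restrict_space borel {a..})"
    and "finite_measure \<mu>"
    and "emeasure \<mu> {a..} \<noteq> 0"
    and "\<And>x. g x = (\<integral>t. 1 / (complex_of_real x - \<i> * complex_of_real t) \<partial>\<mu>)"
    and "\<alpha> > 0" and "\<beta> > 0" and "\<alpha> * \<beta> \<le> 1"
  shows "is_frame_L2 (gabor_system g \<alpha> \<beta>)"
proof -
  interpret half_line_measure \<mu> a
    using assms by (simp add: half_line_measure_def half_line_measure_axioms_def)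
  define T where "T = 1 / \<beta>"
  define \<Lambda> where "\<Lambda> = 2 * pi / \<alpha>"
  have T: "T > 0" and \<Lambda>: "\<Lambda> > 0" "2 * pi / T \<le> \<Lambda>" and \<alpha>: "2 * pi / \<Lambda> = \<alpha>"
    using assms(6-8) by (auto simp: T_def \<Lambda>_def field_simps)
  have gG: "g x = cnj (conj_window x)" for x
  proof -
    have "g x = (\<integral>t. cnj (1 / (complex_of_real x + \<i> * complex_of_real t)) \<partial>\<mu>)"
      unfolding assms(5) by (intro Bochner_Integration.integral_cong refl) simp
    then show ?thesis unfolding conj_window_def by (simp only: Bochner_Integration.integral_cnj)
  qed
  have g: "g \<in> square_integrable"
    using conj_window_square_integrable unfolding gG[abs_def] by (auto simp: square_integrable_def)
  define Ls where "Ls = 2 * pi / T"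
  have Ls: "Ls > 0" using T by (simp add: Ls_def)
  define A where "A = \<Lambda> * Ls * (laplace Ls)\<^sup>2 / 4"
  define B where "B = mass\<^sup>2 * (\<Lambda> * (nat \<lceil>\<Lambda> / Ls\<rceil> * Ls) / (1 - exp (- a * \<Lambda>))\<^sup>2)"
  have A: "A > 0" using laplace_pos[of Ls] Ls \<Lambda> by (simp add: A_def)
  have B: "B \<ge> 0"
    unfolding B_def using Ls \<Lambda>
    by (intro mult_nonneg_nonneg divide_nonneg_nonneg of_nat_0_le_iff zero_le_power2) auto
  \<comment> \<open>The constants A and B do not involve x and K, so the discrete estimate can be integrated over x.\<close>
  have fiber: "(\<lambda>m. (cmod (\<Sum>k\<in>K. c k * conj_window (x + of_int k * T - \<alpha> * of_int m)))\<^sup>2) summable_on UNIV \<and>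
      A * (\<Sum>k\<in>K. (cmod (c k))\<^sup>2) \<le> (\<Sum>\<^sub>\<infinity>m. (cmod (\<Sum>k\<in>K. c k * conj_window (x + of_int k * T - \<alpha> * of_int m)))\<^sup>2) \<and>
      (\<Sum>\<^sub>\<infinity>m. (cmod (\<Sum>k\<in>K. c k * conj_window (x + of_int k * T - \<alpha> * of_int m)))\<^sup>2) \<le> B * (\<Sum>k\<in>K. (cmod (c k))\<^sup>2)"
    if K: "finite K" for x K c
  proof -
    interpret sampling T \<Lambda> x K \<mu> a
      by unfold_locales (use T \<Lambda> K in auto)
    have period: "period = Ls" by (simp add: period_def Ls_def)
    show ?thesis
      using window_sum_summable[of c] window_sum_upper[of c] window_sum_lower[of c]
      by (simp add: window_sum_def bessel_const_def node_def A_def B_def period \<alpha>)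
  qed
  have fr: "(\<lambda>i. (cmod (ip_L2 h (gabor_system g \<alpha> \<beta> i)))\<^sup>2) summable_on UNIV \<and>
        (T * A) * (norm_L2 h)\<^sup>2 \<le> (\<Sum>\<^sub>\<infinity>i. (cmod (ip_L2 h (gabor_system g \<alpha> \<beta> i)))\<^sup>2) \<and>
        (\<Sum>\<^sub>\<infinity>i. (cmod (ip_L2 h (gabor_system g \<alpha> \<beta> i)))\<^sup>2) \<le> (T * B + 1) * (norm_L2 h)\<^sup>2"
    if h: "h \<in> square_integrable" and supp: "\<And>x. x \<notin> {- real N * T..<real N * T} \<Longrightarrow> h x = 0" for h N
  proof -
    let ?K = "{- int N..<int N}"
    define F where "F m = (\<lambda>x. \<Sum>k\<in>?K. h (x + of_int k * T) * conj_window (x + of_int k * T - \<alpha> * of_int m))"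
      for m :: int
    define H where "H x = (\<Sum>k\<in>?K. (cmod (h (x + of_int k * T)))\<^sup>2)" for x
    define l where "l x = (\<Sum>\<^sub>\<infinity>m. (cmod (F m x))\<^sup>2)" for x
    have h_m [measurable]: "h \<in> borel_measurable borel" and h_i: "integrable lborel (\<lambda>x. (cmod (h x))\<^sup>2)"
      using h by (auto simp: square_integrable_def)
    have fold: "(\<integral>x. (cmod (h x))\<^sup>2 \<partial>lborel) = (\<integral>x. H x \<partial>seg T)"
       "integrable (seg T) (\<lambda>x. (cmod (h (x + of_int k * T)))\<^sup>2)" for k
      using integral_fold_seg[OF T h_i, of N] supp unfolding H_def by auto
    have H_i: "integrable (seg T) H" unfolding H_def using fold(2) by simp
    have F_L2: "F m \<in> L2_seg T" for m
    proof -
      have "(\<lambda>x. conj_window (x + of_int k * T - \<alpha> * of_int m) * h (x + of_int k * T)) \<in> L2_seg T" for k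
        by (rule L2_seg_mult_bounded[of _ _ _ "mass / a"])
           (use fold(2)[of k] conj_window_bounded in \<open>auto simp: L2_seg_def\<close>)
      then show ?thesis unfolding F_def by (intro L2_seg_sum) (simp_all add: mult.commute)
    qed
    have row: "((\<lambda>n. (cmod (ip_L2 h (gabor_system g \<alpha> \<beta> (m, n))))\<^sup>2) has_sum
          T * (\<integral>x. (cmod (F m x))\<^sup>2 \<partial>seg T)) UNIV" for m
    proof -
      have "ip_L2 h (gabor_system g \<alpha> \<beta> (m, n)) = fourier_coeff T (F m) n" for n
        using ip_L2_gabor_system[OF assms(7) h g, of N \<alpha> m n] supp by (simp add: T_def F_def gG)
      then show ?thesis using parseval[OF T F_L2] by simp
    qed
    have fib: "((\<lambda>m. (cmod (F m x))\<^sup>2) has_sum l x) UNIV" "A * H x \<le> l x" "l x \<le> B * H x" for x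
      using fiber[of ?K "\<lambda>k. h (x + of_int k * T)" x] by (auto simp: l_def F_def H_def has_sum_iff)
    have fin: "(\<Sum>m\<in>X. (cmod (F m x))\<^sup>2) \<le> B * H x" if "finite X" for x X
      using finite_sum_le_has_sum[OF fib(1) that, of x] fib(3)[of x] by simp
    have F_i: "integrable (seg T) (\<lambda>x. (cmod (F m x))\<^sup>2)" for m
      using F_L2[of m] by (simp add: L2_seg_def)
    have lim: "integrable (seg T) l"
       "(\<lambda>M. \<Sum>m\<in>{- int M..int M}. \<integral>x. (cmod (F m x))\<^sup>2 \<partial>seg T) \<longlonglongrightarrow> (\<integral>x. l x \<partial>seg T)"
      using integral_int_sum_LIMSEQ[OF F_i fib(1) integrable_mult_right[OF H_i], of B] fin
      by (auto simp: sum_nonneg)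
    have norm: "(norm_L2 h)\<^sup>2 = (\<integral>x. H x \<partial>seg T)" by (simp add: norm_L2_square fold(1))
    define I where "I m = (\<integral>x. (cmod (F m x))\<^sup>2 \<partial>seg T)" for m
    have I_fin: "sum I X \<le> B * (norm_L2 h)\<^sup>2" if "finite X" for X
    proof -
      have "sum I X = (\<integral>x. (\<Sum>m\<in>X. (cmod (F m x))\<^sup>2) \<partial>seg T)"
        unfolding I_def using F_i by simp
      also have "\<dots> \<le> (\<integral>x. B * H x \<partial>seg T)"
        by (intro integral_mono Bochner_Integration.integrable_sum integrable_mult_right F_i H_i fin that)
      finally show ?thesis by (simp add: norm)
    qed
    have "0 \<le> I m" for m by (simp add: I_def)
    then have I_summ: "I summable_on UNIV"
      by (intro nonneg_bdd_above_summable_on) (auto intro!: bdd_aboveI[of _ "B * (norm_L2 h)\<^sup>2"] I_fin)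
    have I_sum: "(I has_sum infsum I UNIV) UNIV" using I_summ by simp
    have "A * (norm_L2 h)\<^sup>2 = (\<integral>x. A * H x \<partial>seg T)" by (simp add: norm)
    also have "\<dots> \<le> (\<integral>x. l x \<partial>seg T)"
      by (intro integral_mono integrable_mult_right H_i lim fib)
    also have "\<dots> = infsum I UNIV"
      using LIMSEQ_unique[OF lim(2)] has_sum_int_LIMSEQ[OF I_sum] unfolding I_def by blast
    finally have low: "A * (norm_L2 h)\<^sup>2 \<le> infsum I UNIV" .
    have upp: "infsum I UNIV \<le> B * (norm_L2 h)\<^sup>2"
      by (rule infsum_le_finite_sums[OF I_summ I_fin])
    have TI: "((\<lambda>m. T * I m) has_sum T * infsum I UNIV) UNIV"
      by (intro has_sum_cmult_right I_sum)
    let ?q = "\<lambda>i. (cmod (ip_L2 h (gabor_system g \<alpha> \<beta> i)))\<^sup>2"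
    have "?q summable_on (UNIV \<times> UNIV)"
      using row TI by (intro summable_on_SigmaI[where g = "\<lambda>m. T * I m"]) (auto simp: I_def has_sum_iff)
    then have "(?q has_sum T * infsum I UNIV) (UNIV \<times> UNIV)"
      using row TI by (intro has_sum_SigmaI[where g = "\<lambda>m. T * I m"]) (auto simp: I_def)
    then have q: "(?q has_sum T * infsum I UNIV) UNIV" by simp
    have "T * A * (norm_L2 h)\<^sup>2 \<le> T * infsum I UNIV" 
      using low T by (simp add: mult.assoc)
    moreover have "T * infsum I UNIV \<le> (T * B + 1) * (norm_L2 h)\<^sup>2"
      using mult_left_mono[OF upp, of T] T by (simp add: distrib_right mult.assoc add_increasing2)
    ultimately show ?thesis using q by (simp add: has_sum_iff)
  qed
  show ?thesis
  proof (rule is_frame_L2_from_bounded_support[OF T])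
    show "0 < T * A" using T A by simp
    show "0 < T * B + 1" using T B by (simp add: add_nonneg_pos)
    show "gabor_system g \<alpha> \<beta> i \<in> square_integrable" for i
      unfolding gabor_system_def by (auto intro: time_freq_shift_square_integrable[OF g] split: prod.split)
  qed (rule fr)
qed

end
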